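(* Let $p$ be a prime and let $a(v)$ denote the number of isomorphism classes of affine Mendelsohn quasigroups of order $v$. (i) If $p\equiv 1\pmod 3$, then $a(p)=2$ and $a(p^2)=5$. (ii) If $p\equiv 2\pmod 3$, then $a(p)=0$ and $a(p^2)=1$. (iii) $a(3)=1$ and $a(9)=2$.
   Context: A Mendelsohn quasigroup is an idempotent quasigroup $(V,\circ)$ satisfying $x\circ(y\circ x)=y$ for all $x,y\in V$. A quasigroup is affine if it is isomorphic to $\mathrm{Aff}(G,k)=(G,*_k)$ with $x*_k y=(x-k(x))+k(y)$, where $(G,+)$ is an Abelian group and $k$ and $x\mapsto x-k(x)$ are both automorphisms of $G$. *)

theory Defs
  imports "HOL-Algebra.Group" "HOL-Number_Theory.Cong" "HOL-Computational_Algebra.Primes"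
begin

locale quasigroup =
  fixes V :: "'a set" and f :: "'a \<Rightarrow> 'a \<Rightarrow> 'a"
  assumes closed: "\<lbrakk>x \<in> V; y \<in> V\<rbrakk> \<Longrightarrow> f x y \<in> V"
    and left_division: "\<lbrakk>a \<in> V; b \<in> V\<rbrakk> \<Longrightarrow> \<exists>!x. x \<in> V \<and> f a x = b"
    and right_division: "\<lbrakk>a \<in> V; b \<in> V\<rbrakk> \<Longrightarrow> \<exists>!y. y \<in> V \<and> f y a = b"

locale mendelsohn_quasigroup = quasigroup +
  assumes idempotent: "x \<in> V \<Longrightarrow> f x x = x"
    and semisymmetric: "\<lbrakk>x \<in> V; y \<in> V\<rbrakk> \<Longrightarrow> f x (f y x) = y"

definition magma_isomorphic ::
    "'a set \<Rightarrow> ('a \<Rightarrow> 'a \<Rightarrow> 'a) \<Rightarrow> 'b set \<Rightarrow> ('b \<Rightarrow> 'b \<Rightarrow> 'b) \<Rightarrow> bool" where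
  "magma_isomorphic V f W g \<longleftrightarrow>
     (\<exists>\<phi>. bij_betw \<phi> V W \<and> (\<forall>x\<in>V. \<forall>y\<in>V. \<phi> (f x y) = g (\<phi> x) (\<phi> y)))"

text \<open>Abelian groups are written multiplicatively, as in \<open>HOL-Algebra\<close>: the group difference
  \<open>x - k(x)\<close> is \<open>x \<otimes> inv (k x)\<close>.\<close>

definition one_minus :: "('a, 'm) monoid_scheme \<Rightarrow> ('a \<Rightarrow> 'a) \<Rightarrow> 'a \<Rightarrow> 'a" where
  "one_minus G k x = x \<otimes>\<^bsub>G\<^esub> inv\<^bsub>G\<^esub> (k x)"

definition Aff_op :: "('a, 'm) monoid_scheme \<Rightarrow> ('a \<Rightarrow> 'a) \<Rightarrow> 'a \<Rightarrow> 'a \<Rightarrow> 'a" where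
  "Aff_op G k x y = one_minus G k x \<otimes>\<^bsub>G\<^esub> k y"

text \<open>The group \<open>G\<close> is taken over the element type of \<open>V\<close>. This is no restriction, because a
  group structure can be transported along a bijection; see \<open>affine_quasigroup_any_typeI\<close> below.\<close>

definition affine_quasigroup :: "'a set \<Rightarrow> ('a \<Rightarrow> 'a \<Rightarrow> 'a) \<Rightarrow> bool" where
  "affine_quasigroup V f \<longleftrightarrow>
     (\<exists>(G :: 'a monoid) k. comm_group G \<and> k \<in> iso G G \<and> one_minus G k \<in> iso G G \<and>
        magma_isomorphic V f (carrier G) (Aff_op G k))"

text \<open>Every quasigroup of finite order is isomorphic to one whose underlying set consists of
  natural numbers, so these suffice for counting isomorphism classes.\<close>

definition affine_mendelsohn_quasigroups :: "nat \<Rightarrow> (nat set \<times> (nat \<Rightarrow> nat \<Rightarrow> nat)) set" where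
  "affine_mendelsohn_quasigroups v =
     {(V, f). finite V \<and> card V = v \<and> mendelsohn_quasigroup V f \<and> affine_quasigroup V f}"

definition isomorphism_relation ::
    "('a set \<times> ('a \<Rightarrow> 'a \<Rightarrow> 'a)) set \<Rightarrow> (('a set \<times> ('a \<Rightarrow> 'a \<Rightarrow> 'a)) \<times> ('a set \<times> ('a \<Rightarrow> 'a \<Rightarrow> 'a))) set" where
  "isomorphism_relation A =
     {((V, f), (W, g)). (V, f) \<in> A \<and> (W, g) \<in> A \<and> magma_isomorphic V f W g}"

definition num_affine_mendelsohn :: "nat \<Rightarrow> nat" where
  "num_affine_mendelsohn v =
     card (affine_mendelsohn_quasigroups v //
           isomorphism_relation (affine_mendelsohn_quasigroups v))"


lemma magma_isomorphic_refl: "magma_isomorphic V f V f"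
  unfolding magma_isomorphic_def by (rule exI[of _ id]) auto

lemma magma_isomorphic_sym:
  assumes iso: "magma_isomorphic V f W g" and cl: "\<And>x y. \<lbrakk>x \<in> V; y \<in> V\<rbrakk> \<Longrightarrow> f x y \<in> V"
  shows "magma_isomorphic W g V f"
proof -
  obtain \<phi> where b: "bij_betw \<phi> V W"
    and h: "\<And>x y. \<lbrakk>x \<in> V; y \<in> V\<rbrakk> \<Longrightarrow> \<phi> (f x y) = g (\<phi> x) (\<phi> y)"
    using iso unfolding magma_isomorphic_def by blast
  let ?\<psi> = "inv_into V \<phi>"
  have b': "bij_betw ?\<psi> W V" using b by (rule bij_betw_inv_into)
  have "?\<psi> (g x y) = f (?\<psi> x) (?\<psi> y)" if "x \<in> W" "y \<in> W" for x y
  proof -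
    have m: "?\<psi> x \<in> V" "?\<psi> y \<in> V" using that b' by (auto simp: bij_betw_def)
    have "\<phi> (f (?\<psi> x) (?\<psi> y)) = g x y"
      using h[OF m] b that by (simp add: bij_betw_inv_into_right)
    then show ?thesis using bij_betw_inv_into_left[OF b cl[OF m]] by simp
  qed
  then show ?thesis using b' unfolding magma_isomorphic_def by blast
qed

lemma magma_isomorphic_trans:
  assumes "magma_isomorphic V f W g" and "magma_isomorphic W g U h"
  shows "magma_isomorphic V f U h"
proof -
  obtain \<phi> \<psi> where "bij_betw \<phi> V W" "bij_betw \<psi> W U"
    "\<forall>x\<in>V. \<forall>y\<in>V. \<phi> (f x y) = g (\<phi> x) (\<phi> y)" "\<forall>x\<in>W. \<forall>y\<in>W. \<psi> (g x y) = h (\<psi> x) (\<psi> y)"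
    using assms unfolding magma_isomorphic_def by blast
  then show ?thesis unfolding magma_isomorphic_def
    by (intro exI[of _ "\<psi> \<circ> \<phi>"]) (auto intro: bij_betw_trans simp: bij_betwE)
qed

lemma equiv_isomorphism_relation:
  "equiv (affine_mendelsohn_quasigroups v) (isomorphism_relation (affine_mendelsohn_quasigroups v))"
proof (rule equivI)
  let ?A = "affine_mendelsohn_quasigroups v"
  show "isomorphism_relation ?A \<subseteq> ?A \<times> ?A"
    by (auto simp: isomorphism_relation_def)
  show "refl_on ?A (isomorphism_relation ?A)"
    by (auto simp: refl_on_def isomorphism_relation_def magma_isomorphic_refl)
  have "f x y \<in> V" if "(V, f) \<in> ?A" "x \<in> V" "y \<in> V" for V f x y
    using that quasigroup.closed
    by (auto simp: affine_mendelsohn_quasigroups_def mendelsohn_quasigroup_def)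
  then show "sym (isomorphism_relation ?A)"
    by (auto simp: sym_def isomorphism_relation_def intro!: magma_isomorphic_sym)
  show "trans (isomorphism_relation ?A)"
    by (auto simp: trans_def isomorphism_relation_def intro: magma_isomorphic_trans)
qed

lemma affine_quasigroup_any_typeI:
  fixes G :: "('b, 'm) monoid_scheme" and V :: "'a set"
  assumes G: "comm_group G" and k: "k \<in> iso G G" and d: "one_minus G k \<in> iso G G"
    and iso: "magma_isomorphic V f (carrier G) (Aff_op G k)"
  shows "affine_quasigroup V f"
proof -
  interpret G: comm_group G by (rule G)
  obtain \<phi> where b: "bij_betw \<phi> V (carrier G)"
    and h: "\<And>x y. \<lbrakk>x \<in> V; y \<in> V\<rbrakk> \<Longrightarrow> \<phi> (f x y) = Aff_op G k (\<phi> x) (\<phi> y)"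
    using iso unfolding magma_isomorphic_def by blast
  define \<psi> where "\<psi> = inv_into V \<phi>"
  define H :: "'a monoid" where
    "H = \<lparr>carrier = V, monoid.mult = (\<lambda>x y. \<psi> (\<phi> x \<otimes>\<^bsub>G\<^esub> \<phi> y)), monoid.one = \<psi> \<one>\<^bsub>G\<^esub>\<rparr>"
  have b': "bij_betw \<psi> (carrier G) V" unfolding \<psi>_def using b by (rule bij_betw_inv_into)
  have \<phi>[simp]: "\<phi> x \<in> carrier G" if "x \<in> V" for x using b that by (auto simp: bij_betw_def)
  have \<psi>[simp]: "\<psi> x \<in> V" if "x \<in> carrier G" for x using b' that by (auto simp: bij_betw_def)
  have \<phi>\<psi>[simp]: "\<phi> (\<psi> x) = x" if "x \<in> carrier G" for x
    using that b by (simp add: \<psi>_def bij_betw_inv_into_right)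
  have \<psi>\<phi>[simp]: "\<psi> (\<phi> x) = x" if "x \<in> V" for x
    using that b by (simp add: \<psi>_def bij_betw_inv_into_left)
  have monH: "monoid H"
    by (rule monoidI) (auto simp: H_def G.m_assoc)
  have \<psi>iso: "\<psi> \<in> iso G H"
    using b' by (auto simp: iso_def hom_def H_def)
  have \<phi>iso: "\<phi> \<in> iso H G"
    using b by (auto simp: iso_def hom_def H_def)
  have cH: "comm_group H"
    using G.iso_imp_comm_group monH \<psi>iso by (auto simp: is_iso_def)
  interpret H: comm_group H by (rule cH)
  define k' where "k' = \<psi> \<circ> (k \<circ> \<phi>)"
  have kc[simp]: "k x \<in> carrier G" if "x \<in> carrier G" for x
    using k that by (auto simp: iso_def hom_def)
  have k': "k' \<in> iso H H"
    unfolding k'_def by (rule iso_set_trans[OF iso_set_trans[OF \<phi>iso k] \<psi>iso])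
  have invH: "inv\<^bsub>H\<^esub> x = \<psi> (inv\<^bsub>G\<^esub> (\<phi> x))" if "x \<in> V" for x
    by (rule H.inv_equality) (use that in \<open>auto simp: H_def\<close>)
  have d_eq: "one_minus H k' x = (\<psi> \<circ> (one_minus G k \<circ> \<phi>)) x" if "x \<in> V" for x
    using that invH[of "k' x"] by (simp add: one_minus_def k'_def) (simp add: H_def)
  have "\<psi> \<circ> (one_minus G k \<circ> \<phi>) \<in> iso H H"
    by (rule iso_set_trans[OF iso_set_trans[OF \<phi>iso d] \<psi>iso])
  then have d': "one_minus H k' \<in> iso H H"
    by (rule H.iso_eq) (use d_eq in \<open>simp add: H_def\<close>)
  have "\<psi> (Aff_op G k x y) = Aff_op H k' (\<psi> x) (\<psi> y)" if "x \<in> carrier G" "y \<in> carrier G" for x y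
  proof -
    have "one_minus G k x \<in> carrier G"
      using that by (simp add: one_minus_def)
    moreover have "one_minus H k' (\<psi> x) = \<psi> (one_minus G k x)" "k' (\<psi> y) = \<psi> (k y)"
      using that d_eq[of "\<psi> x"] by (simp_all add: k'_def)
    ultimately show ?thesis
      using that by (simp add: Aff_op_def) (simp add: H_def)
  qed
  then have "magma_isomorphic (carrier G) (Aff_op G k) (carrier H) (Aff_op H k')"
    unfolding magma_isomorphic_def using b' by (intro exI[of _ \<psi>]) (simp add: H_def)
  then have "magma_isomorphic V f (carrier H) (Aff_op H k')"
    by (rule magma_isomorphic_trans[OF iso])
  then show ?thesis unfolding affine_quasigroup_def using cH k' d' by blast
qed


lemma mendelsohn_quasigroup_transport:
  assumes iso: "magma_isomorphic V f W g" and Q: "mendelsohn_quasigroup V f"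
    and clW: "\<And>x y. \<lbrakk>x \<in> W; y \<in> W\<rbrakk> \<Longrightarrow> g x y \<in> W"
  shows "mendelsohn_quasigroup W g"
proof -
  interpret Q: mendelsohn_quasigroup V f by (rule Q)
  obtain \<phi> where b: "bij_betw \<phi> W V"
    and h: "\<And>x y. \<lbrakk>x \<in> W; y \<in> W\<rbrakk> \<Longrightarrow> \<phi> (g x y) = f (\<phi> x) (\<phi> y)"
    using magma_isomorphic_sym[OF iso Q.closed] unfolding magma_isomorphic_def by blast
  have mem: "\<phi> x \<in> V" if "x \<in> W" for x using b that by (auto simp: bij_betw_def)
  have inj: "\<phi> x = \<phi> y \<longleftrightarrow> x = y" if "x \<in> W" "y \<in> W" for x y
    using b that by (auto simp: bij_betw_def inj_on_eq_iff)
  have surj: "\<exists>x\<in>W. \<phi> x = y" if "y \<in> V" for y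
    using b that by (auto simp: bij_betw_def)
  show ?thesis
  proof
    fix a c assume ac: "a \<in> W" "c \<in> W"
    obtain z where z: "z \<in> V" "f (\<phi> a) z = \<phi> c" "\<And>z'. z' \<in> V \<Longrightarrow> f (\<phi> a) z' = \<phi> c \<Longrightarrow> z' = z"
      using Q.left_division[OF mem[OF ac(1)] mem[OF ac(2)]] by blast
    obtain w where w: "w \<in> W" "\<phi> w = z" using surj z(1) by blast
    show "\<exists>!x. x \<in> W \<and> g a x = c"
    proof (intro ex1I[of _ w] conjI)
      have "\<phi> (g a w) = \<phi> c" using w z(2) ac by (simp add: h)
      then show "g a w = c" using inj clW w ac by blast
    next
      fix w' assume w': "w' \<in> W \<and> g a w' = c"
      then have "f (\<phi> a) (\<phi> w') = \<phi> c" using h ac by metis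
      then have "\<phi> w' = \<phi> w" using z(3) mem w w' by blast
      then show "w' = w" using inj w w' by blast
    qed (rule w(1))
    obtain z where z: "z \<in> V" "f z (\<phi> a) = \<phi> c" "\<And>z'. z' \<in> V \<Longrightarrow> f z' (\<phi> a) = \<phi> c \<Longrightarrow> z' = z"
      using Q.right_division[OF mem[OF ac(1)] mem[OF ac(2)]] by blast
    obtain w where w: "w \<in> W" "\<phi> w = z" using surj z(1) by blast
    show "\<exists>!y. y \<in> W \<and> g y a = c"
    proof (intro ex1I[of _ w] conjI)
      have "\<phi> (g w a) = \<phi> c" using w z(2) ac by (simp add: h)
      then show "g w a = c" using inj clW w ac by blast
    next
      fix w' assume w': "w' \<in> W \<and> g w' a = c"
      then have "f (\<phi> w') (\<phi> a) = \<phi> c" using h ac by metis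
      then have "\<phi> w' = \<phi> w" using z(3) mem w w' by blast
      then show "w' = w" using inj w w' by blast
    qed (rule w(1))
  next
    fix x assume x: "x \<in> W"
    have "\<phi> (g x x) = \<phi> x" using x by (simp add: h mem Q.idempotent)
    then show "g x x = x" using inj clW x by blast
  next
    fix x y assume xy: "x \<in> W" "y \<in> W"
    have "\<phi> (g x (g y x)) = \<phi> y" using xy by (simp add: h mem clW Q.semisymmetric)
    then show "g x (g y x) = y" using inj clW xy by blast
  qed (rule clW)
qed

text \<open>Every affine Mendelsohn quasigroup of finite order, over any type, is represented.\<close>

lemma affine_mendelsohn_representative:
  fixes V :: "'a set"
  assumes fin: "finite V" and Q: "mendelsohn_quasigroup V f" and aff: "affine_quasigroup V f"
  obtains g where "g \<in> {..<card V} \<rightarrow>\<^sub>E ({..<card V} \<rightarrow>\<^sub>E {..<card V})"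
    and "({..<card V}, g) \<in> affine_mendelsohn_quasigroups (card V)"
    and "magma_isomorphic V f {..<card V} g"
proof -
  interpret Q: mendelsohn_quasigroup V f by (rule Q)
  let ?W = "{..<card V}"
  obtain \<phi> where b: "bij_betw \<phi> V ?W"
    using ex_bij_betw_finite_nat[OF fin] by (auto simp: atLeast0LessThan)
  define \<psi> where "\<psi> = inv_into V \<phi>"
  have b': "bij_betw \<psi> ?W V" unfolding \<psi>_def using b by (rule bij_betw_inv_into)
  define g where "g = (\<lambda>x\<in>?W. \<lambda>y\<in>?W. \<phi> (f (\<psi> x) (\<psi> y)))"
  have \<phi>: "\<phi> x \<in> ?W" if "x \<in> V" for x using b that unfolding bij_betw_def by blast
  have \<psi>: "\<psi> x \<in> V" if "x \<in> ?W" for x using b' that unfolding bij_betw_def by blast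
  have cl: "g x y \<in> ?W" if "x \<in> ?W" "y \<in> ?W" for x y
    using that \<phi>[OF Q.closed[OF \<psi> \<psi>]] by (simp add: g_def)
  have 1: "g \<in> ?W \<rightarrow>\<^sub>E (?W \<rightarrow>\<^sub>E ?W)"
  proof (rule PiE_I)
    fix x assume x: "x \<in> ?W"
    show "g x \<in> ?W \<rightarrow>\<^sub>E ?W"
    proof (rule PiE_I)
      show "g x y \<in> ?W" if "y \<in> ?W" for y using cl x that by blast
      show "g x y = undefined" if "y \<notin> ?W" for y using x that by (simp add: g_def)
    qed
  next
    show "g x = undefined" if "x \<notin> ?W" for x using that by (simp add: g_def)
  qed
  have "\<phi> (f x y) = g (\<phi> x) (\<phi> y)" if "x \<in> V" "y \<in> V" for x y
    using \<phi> that b by (simp add: g_def \<psi>_def bij_betw_inv_into_left)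
  then have iso: "magma_isomorphic V f ?W g"
    using b unfolding magma_isomorphic_def by blast
  obtain G :: "'a monoid" and k where G: "comm_group G" "k \<in> iso G G" "one_minus G k \<in> iso G G"
    and VG: "magma_isomorphic V f (carrier G) (Aff_op G k)"
    using aff unfolding affine_quasigroup_def by blast
  have "affine_quasigroup ?W g"
    using G magma_isomorphic_trans[OF magma_isomorphic_sym[OF iso Q.closed] VG]
    by (rule affine_quasigroup_any_typeI)
  then have "(?W, g) \<in> affine_mendelsohn_quasigroups (card V)"
    using mendelsohn_quasigroup_transport[OF iso Q cl]
    by (simp add: affine_mendelsohn_quasigroups_def)
  then show thesis using that 1 iso by blast
qed

lemma finite_affine_mendelsohn_classes:
  "finite (affine_mendelsohn_quasigroups v //
     isomorphism_relation (affine_mendelsohn_quasigroups v))"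
proof (rule finite_subset)
  let ?A = "affine_mendelsohn_quasigroups v" let ?r = "isomorphism_relation ?A"
  let ?F = "{..<v} \<rightarrow>\<^sub>E ({..<v} \<rightarrow>\<^sub>E {..<v})"
  show "?A // ?r \<subseteq> (\<lambda>g. ?r `` {({..<v}, g)}) ` ?F"
  proof
    fix C assume "C \<in> ?A // ?r"
    then obtain V f where C: "C = ?r `` {(V, f)}" and Vf: "(V, f) \<in> ?A"
      unfolding quotient_def by auto
    then have "finite V" "mendelsohn_quasigroup V f" "affine_quasigroup V f" and v: "card V = v"
      by (auto simp: affine_mendelsohn_quasigroups_def)
    then obtain g where "g \<in> ?F" "({..<v}, g) \<in> ?A" "magma_isomorphic V f {..<v} g"
      using affine_mendelsohn_representative by metis
    moreover from this have "((V, f), ({..<v}, g)) \<in> ?r"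
      using Vf by (simp add: isomorphism_relation_def)
    ultimately show "C \<in> (\<lambda>g. ?r `` {({..<v}, g)}) ` ?F"
      using C equiv_class_eq[OF equiv_isomorphism_relation] by blast
  qed
  show "finite ((\<lambda>g. ?r `` {({..<v}, g)}) ` ?F)"
    by (intro finite_imageI finite_PiE) auto
qed

end

theory Submission
  imports Defs "HOL-Algebra.Elementary_Groups" "HOL-Number_Theory.Number_Theory"
begin

text \<open>
  In \<open>Aff(G, k)\<close> the identity \<open>x \<circ> (y \<circ> x) = y\<close> says exactly that \<open>k\<^sup>2 - k + 1 = 0\<close>, so the
  quasigroups to be counted are the modules over \<open>\<int>[t] / (t\<^sup>2 - t + 1)\<close> of the given order. On a
  cyclic group \<open>k\<close> is multiplication by a root of \<open>t\<^sup>2 - t + 1\<close>. On an elementary Abelian group of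
  order \<open>p\<^sup>2\<close> it is either such a scalar, or there is a vector \<open>u\<close> with \<open>u, k u\<close> independent, and
  in this basis \<open>k\<close> is the companion matrix. With \<open>r(n)\<close> the number of roots modulo \<open>n\<close> this gives
  \<open>a(p) = r(p)\<close> and \<open>a(p\<^sup>2) = r(p\<^sup>2) + r(p) + 1\<close>.
\<close>

section \<open>Affine Mendelsohn quasigroups as modules\<close>

text \<open>This is the relation \<open>k^2 - k + 1 = 0\<close> in multiplicative notation,
  rearranged to \<open>k^2 + 1 = k\<close> so that no inverse occurs. Bijectivity of
  \<open>k\<close> is not demanded, since it follows from the relation.\<close>

definition mendelsohn_endo :: "('a, 'm) monoid_scheme \<Rightarrow> ('a \<Rightarrow> 'a) \<Rightarrow> bool" where
  "mendelsohn_endo G k \<longleftrightarrow>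
     k \<in> hom G G \<and> (\<forall>x\<in>carrier G. k (k x) \<otimes>\<^bsub>G\<^esub> x = k x)"

text \<open>The relation reads \<open>k (1 - k) = 1\<close>, so \<open>k\<close> and
  \<open>d = 1 - k\<close> are inverse to each other, and both are automorphisms. Division in the
  quasigroup then amounts to applying \<open>d\<close> to undo \<open>k\<close>, or \<open>k\<close>
  to undo \<open>d\<close>.\<close>

lemma mendelsohn_endo_affine:
  fixes G (structure)
  assumes G: "comm_group G" and k: "mendelsohn_endo G k"
  shows "k \<in> iso G G" and "one_minus G k \<in> iso G G"
    and "mendelsohn_quasigroup (carrier G) (Aff_op G k)"
proof -
  interpret comm_group G by (rule G)
  define d where "d = one_minus G k"
  have hom: "k \<in> hom G G" and sq: "\<And>x. x \<in> carrier G \<Longrightarrow> k (k x) \<otimes> x = k x"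
    using k by (auto simp: mendelsohn_endo_def)
  interpret kh: group_hom G G k using hom by unfold_locales
  have kc[simp]: "k x \<in> carrier G" if "x \<in> carrier G" for x using that by simp
  have d_def': "d x = x \<otimes> inv (k x)" for x by (simp add: d_def one_minus_def)
  have dc[simp]: "d x \<in> carrier G" if "x \<in> carrier G" for x using that by (simp add: d_def')
  have kk: "k x \<otimes> inv (k (k x)) = x" if "x \<in> carrier G" for x
  proof -
    have "k x \<otimes> inv (k (k x)) = x \<otimes> k (k x) \<otimes> inv (k (k x))"
      using sq[OF that] that by (simp add: m_comm)
    then show ?thesis using that by (simp add: m_assoc)
  qed
  have kd[simp]: "k (d x) = x" if "x \<in> carrier G" for x
    using that by (simp add: d_def' kk)
  have dk[simp]: "d (k x) = x" if "x \<in> carrier G" for x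
    using that by (simp add: d_def' kk)
  have dkm[simp]: "d x \<otimes> k x = x" if "x \<in> carrier G" for x
    using that by (simp add: d_def' m_assoc)
  have dm: "d (x \<otimes> y) = d x \<otimes> d y" if "x \<in> carrier G" "y \<in> carrier G" for x y
    using that by (simp add: d_def' inv_mult m_ac)
  show "k \<in> iso G G"
    unfolding iso_def using hom by (auto intro!: bij_betw_byWitness[where f' = d])
  show "one_minus G k \<in> iso G G"
    unfolding iso_def d_def[symmetric]
    by (auto simp: hom_def dm intro!: bij_betw_byWitness[where f' = k])
  have op: "Aff_op G k x y = d x \<otimes> k y" for x y by (simp add: Aff_op_def d_def)
  show "mendelsohn_quasigroup (carrier G) (Aff_op G k)"
  proof
    fix a b assume ab: "a \<in> carrier G" "b \<in> carrier G"
    show "Aff_op G k a b \<in> carrier G" using ab by (simp add: op)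
    show "\<exists>!x. x \<in> carrier G \<and> Aff_op G k a x = b"
    \<comment> \<open>The witness solves \<open>d a + k x = b\<close> in additive notation, with
      \<open>d\<close> in the role of the inverse of \<open>k\<close>.\<close>
    proof (intro ex1I[of _ "d (inv (d a) \<otimes> b)"] conjI)
      show "Aff_op G k a (d (inv (d a) \<otimes> b)) = b"
        using ab by (simp add: op flip: m_assoc)
      fix y assume y: "y \<in> carrier G \<and> Aff_op G k a y = b"
      then have "inv (d a) \<otimes> b = k y" using ab by (auto simp: op simp flip: m_assoc)
      then show "y = d (inv (d a) \<otimes> b)" using y by simp
    qed (use ab in simp)
    show "\<exists>!y. y \<in> carrier G \<and> Aff_op G k y a = b"
    proof (intro ex1I[of _ "k (b \<otimes> inv (k a))"] conjI)
      show "Aff_op G k (k (b \<otimes> inv (k a))) a = b"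
        using ab by (simp add: op m_assoc del: kh.hom_mult kh.hom_inv)
      fix y assume y: "y \<in> carrier G \<and> Aff_op G k y a = b"
      then have "b \<otimes> inv (k a) = d y" using ab by (auto simp: op m_assoc)
      then show "y = k (b \<otimes> inv (k a))" using y by simp
    qed (use ab in simp)
    show "Aff_op G k a a = a" using ab by (simp add: op)
    \<comment> \<open>Additively, \<open>a \<circ> (b \<circ> a) = d a + k (d b) + k (k a)\<close>,
      where \<open>k (d b) = b\<close>. It remains to see that the two terms in \<open>a\<close>
      cancel.\<close>
    have "d a \<otimes> k (k a) = k (k a) \<otimes> a \<otimes> inv (k a)"
      using ab by (simp add: d_def' m_ac)
    then have "d a \<otimes> k (k a) = \<one>" using ab by (simp add: sq)
    then show "Aff_op G k a (Aff_op G k b a) = b"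
      using ab by (simp add: op m_lcomm)
  qed
qed

text \<open>Taking the neutral element for \<open>y\<close> in
  \<open>x \<circ> (y \<circ> x) = y\<close> leaves \<open>x - k x + k (k x) = 0\<close>.\<close>

lemma mendelsohn_endoI:
  fixes G (structure)
  assumes G: "comm_group G" and k: "k \<in> hom G G"
    and Q: "mendelsohn_quasigroup (carrier G) (Aff_op G k)"
  shows "mendelsohn_endo G k"
proof -
  interpret comm_group G by (rule G)
  interpret kh: group_hom G G k using k by unfold_locales
  interpret Q: mendelsohn_quasigroup "carrier G" "Aff_op G k" by (rule Q)
  have "k (k x) \<otimes> x = k x" if x: "x \<in> carrier G" for x
  proof -
    have "x \<otimes> inv (k x) \<otimes> k (k x) = \<one>"
      using Q.semisymmetric[OF x one_closed] x by (simp add: Aff_op_def one_minus_def)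
    then have "k x \<otimes> (x \<otimes> inv (k x) \<otimes> k (k x)) = k x" using x by simp
    moreover have "x \<otimes> inv (k x) \<otimes> k (k x) = inv (k x) \<otimes> (k (k x) \<otimes> x)"
      using x by (simp add: m_ac)
    ultimately show ?thesis using x by (simp flip: m_assoc)
  qed
  then show ?thesis using k by (simp add: mendelsohn_endo_def)
qed

text \<open>Translations are automorphisms of \<open>Aff(G, k)\<close>, so an isomorphism may be assumed to fix the
  neutral element; it is then additive because \<open>k\<close> and \<open>1 - k\<close> are onto.\<close>

lemma magma_isomorphic_Aff_iff:
  assumes G: "comm_group G" and k: "mendelsohn_endo G k"
    and H: "comm_group H" and l: "mendelsohn_endo H l"
  shows "magma_isomorphic (carrier G) (Aff_op G k) (carrier H) (Aff_op H l) \<longleftrightarrow>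
    (\<exists>\<phi>\<in>iso G H. \<forall>x\<in>carrier G. \<phi> (k x) = l (\<phi> x))"
proof
  interpret G: comm_group G by (rule G)
  interpret H: comm_group H by (rule H)
  have kiso: "k \<in> iso G G" and diso: "one_minus G k \<in> iso G G"
    using mendelsohn_endo_affine[OF G k] by blast+
  interpret kh: group_hom G G k using kiso by unfold_locales (simp add: iso_def)
  interpret dh: group_hom G G "one_minus G k" using diso by unfold_locales (simp add: iso_def)
  have liso: "l \<in> iso H H" and eiso: "one_minus H l \<in> iso H H"
    using mendelsohn_endo_affine[OF H l] by blast+
  interpret lh: group_hom H H l using liso by unfold_locales (simp add: iso_def)
  interpret eh: group_hom H H "one_minus H l" using eiso by unfold_locales (simp add: iso_def)
  {
    assume "magma_isomorphic (carrier G) (Aff_op G k) (carrier H) (Aff_op H l)"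
    then obtain \<phi> where bij: "bij_betw \<phi> (carrier G) (carrier H)"
      and \<phi>: "\<And>x y. \<lbrakk>x \<in> carrier G; y \<in> carrier G\<rbrakk> \<Longrightarrow> \<phi> (Aff_op G k x y) = Aff_op H l (\<phi> x) (\<phi> y)"
      unfolding magma_isomorphic_def by blast
    have \<phi>c[simp]: "\<phi> x \<in> carrier H" if "x \<in> carrier G" for x
      using bij that by (auto simp: bij_betw_def)
    define a where "a = inv\<^bsub>H\<^esub> (\<phi> \<one>\<^bsub>G\<^esub>)"
    have ac[simp]: "a \<in> carrier H" by (simp add: a_def)
    define \<psi> where "\<psi> x = a \<otimes>\<^bsub>H\<^esub> \<phi> x" for x
    have \<psi>c[simp]: "\<psi> x \<in> carrier H" if "x \<in> carrier G" for x using that by (simp add: \<psi>_def)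
    have \<psi>1[simp]: "\<psi> \<one>\<^bsub>G\<^esub> = \<one>\<^bsub>H\<^esub>" by (simp add: \<psi>_def a_def)
    \<comment> \<open>The operation of \<open>Aff(H, l)\<close> is additive in the pair of its
      arguments. Writing the translating element \<open>a\<close> as a product with itself therefore
      shows that translation by \<open>a\<close> respects the operation.\<close>
    have aa: "Aff_op H l a a = a"
      by (simp add: Aff_op_def one_minus_def H.m_assoc)
    have \<psi>op: "\<psi> (Aff_op G k x y) = Aff_op H l (\<psi> x) (\<psi> y)" if "x \<in> carrier G" "y \<in> carrier G" for x y
    proof -
      have "\<psi> (Aff_op G k x y) = Aff_op H l a a \<otimes>\<^bsub>H\<^esub> Aff_op H l (\<phi> x) (\<phi> y)"
        using that by (simp add: \<psi>_def \<phi> aa)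
      also have "\<dots> = Aff_op H l (\<psi> x) (\<psi> y)"
        using that by (simp add: \<psi>_def Aff_op_def H.m_ac)
      finally show ?thesis .
    qed
    have \<psi>k: "\<psi> (k y) = l (\<psi> y)" if "y \<in> carrier G" for y
      using \<psi>op[of "\<one>\<^bsub>G\<^esub>" y] that by (simp add: Aff_op_def)
    have \<psi>d: "\<psi> (one_minus G k x) = one_minus H l (\<psi> x)" if "x \<in> carrier G" for x
      using \<psi>op[of x "\<one>\<^bsub>G\<^esub>"] that by (simp add: Aff_op_def)
    have "\<psi> (x \<otimes>\<^bsub>G\<^esub> y) = \<psi> x \<otimes>\<^bsub>H\<^esub> \<psi> y" if xy: "x \<in> carrier G" "y \<in> carrier G" for x y
    proof -
      \<comment> \<open>With this choice the group product of \<open>x\<close> and \<open>y\<close>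
        is the quasigroup product of \<open>u\<close> and \<open>v\<close>, which
        \<open>\<psi>\<close> is known to respect.\<close>
      obtain u v where "u \<in> carrier G" "x = one_minus G k u" "v \<in> carrier G" "y = k v"
        using xy kiso diso unfolding iso_def bij_betw_def by blast
      then show ?thesis using \<psi>op[of u v] \<psi>k \<psi>d by (simp add: Aff_op_def)
    qed
    moreover have "bij_betw \<psi> (carrier G) (carrier H)"
    proof -
      have "bij_betw (\<lambda>x. a \<otimes>\<^bsub>H\<^esub> x) (carrier H) (carrier H)"
        by (rule bij_betw_byWitness[where f' = "\<lambda>x. inv\<^bsub>H\<^esub> a \<otimes>\<^bsub>H\<^esub> x"])
          (auto simp flip: H.m_assoc)
      then have "bij_betw ((\<lambda>x. a \<otimes>\<^bsub>H\<^esub> x) \<circ> \<phi>) (carrier G) (carrier H)"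
        by (rule bij_betw_trans[OF bij])
      then show ?thesis by (simp add: \<psi>_def[abs_def] comp_def)
    qed
    ultimately have "\<psi> \<in> iso G H" by (auto simp: iso_def hom_def)
    then show "\<exists>\<phi>\<in>iso G H. \<forall>x\<in>carrier G. \<phi> (k x) = l (\<phi> x)" using \<psi>k by blast
  }
  {
    assume "\<exists>\<phi>\<in>iso G H. \<forall>x\<in>carrier G. \<phi> (k x) = l (\<phi> x)"
    then obtain \<phi> where iso: "\<phi> \<in> iso G H" and \<phi>: "\<And>x. x \<in> carrier G \<Longrightarrow> \<phi> (k x) = l (\<phi> x)"
      by blast
    interpret \<phi>: group_hom G H \<phi> using iso by unfold_locales (simp add: iso_def)
    show "magma_isomorphic (carrier G) (Aff_op G k) (carrier H) (Aff_op H l)"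
      unfolding magma_isomorphic_def
      by (intro exI[of _ \<phi>]) (use iso in \<open>auto simp: iso_def Aff_op_def one_minus_def \<phi>\<close>)
  }
qed

section \<open>Counting isomorphism classes by a system of representatives\<close>

lemma card_quotient_eqI:
  assumes r: "equiv A r" and f: "\<And>i. i \<in> I \<Longrightarrow> f i \<in> A"
    and dist: "\<And>i j. \<lbrakk>i \<in> I; j \<in> I; (f i, f j) \<in> r\<rbrakk> \<Longrightarrow> i = j"
    and compl: "\<And>a. a \<in> A \<Longrightarrow> \<exists>i\<in>I. (a, f i) \<in> r"
  shows "card (A // r) = card I"
proof -
  have "bij_betw (\<lambda>i. r `` {f i}) I (A // r)"
  proof (rule bij_betwI')
    fix i j assume "i \<in> I" "j \<in> I"
    then show "r `` {f i} = r `` {f j} \<longleftrightarrow> i = j"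
      using dist f eq_equiv_class_iff[OF r] by blast
  next
    fix i assume "i \<in> I"
    then show "r `` {f i} \<in> A // r" using f by (simp add: quotientI)
  next
    fix X assume "X \<in> A // r"
    then obtain a where a: "a \<in> A" "X = r `` {a}" by (auto elim: quotientE)
    then obtain i where "i \<in> I" "(a, f i) \<in> r" using compl by blast
    then show "\<exists>i\<in>I. X = r `` {f i}" using a equiv_class_eq[OF r] by blast
  qed
  then show ?thesis by (simp add: bij_betw_same_card)
qed

text \<open>This turns the count of quasigroups into a classification of pairs of a group and an
  endomorphism, up to equivariant isomorphism. The representatives may live over any one type
  \<open>'b\<close>, but completeness has to be checked for groups over \<open>nat\<close>, because
  an affine quasigroup takes its group over its own element type.\<close>

lemma num_affine_mendelsohn_eqI:
  fixes G :: "'i \<Rightarrow> 'b monoid" and k :: "'i \<Rightarrow> 'b \<Rightarrow> 'b"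
  assumes v: "v > 0"
    and G: "\<And>i. i \<in> I \<Longrightarrow> comm_group (G i)" and order: "\<And>i. i \<in> I \<Longrightarrow> order (G i) = v"
    and k: "\<And>i. i \<in> I \<Longrightarrow> mendelsohn_endo (G i) (k i)"
    and dist: "\<And>i j \<phi>. \<lbrakk>i \<in> I; j \<in> I; \<phi> \<in> iso (G i) (G j);
        \<And>x. x \<in> carrier (G i) \<Longrightarrow> \<phi> (k i x) = k j (\<phi> x)\<rbrakk> \<Longrightarrow> i = j"
    and compl: "\<And>(H :: nat monoid) l. \<lbrakk>comm_group H; order H = v; mendelsohn_endo H l\<rbrakk>
        \<Longrightarrow> \<exists>i\<in>I. \<exists>\<phi>\<in>iso H (G i). \<forall>x\<in>carrier H. \<phi> (l x) = k i (\<phi> x)"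
  shows "num_affine_mendelsohn v = card I"
proof -
  let ?A = "affine_mendelsohn_quasigroups v"
  \<comment> \<open>Each representative is transported to an initial segment of the natural numbers,
    where the counted quasigroups live.\<close>
  have "\<exists>f. ({..<v}, f) \<in> ?A \<and>
      magma_isomorphic (carrier (G i)) (Aff_op (G i) (k i)) {..<v} f" if i: "i \<in> I" for i
  proof -
    have card: "card (carrier (G i)) = v" using order[OF i] by (simp add: order_def)
    then have fin: "finite (carrier (G i))" using v by (metis card.infinite less_numeral_extra(3))
    have "affine_quasigroup (carrier (G i)) (Aff_op (G i) (k i))"
      using affine_quasigroup_any_typeI G i mendelsohn_endo_affine[OF G[OF i] k[OF i]]
        magma_isomorphic_refl by metis
    then show ?thesis
      using affine_mendelsohn_representative[OF fin mendelsohn_endo_affine(3)[OF G[OF i] k[OF i]]]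
        card by metis
  qed
  then obtain f where f: "\<And>i. i \<in> I \<Longrightarrow> ({..<v}, f i) \<in> ?A"
    and iso: "\<And>i. i \<in> I \<Longrightarrow> magma_isomorphic (carrier (G i)) (Aff_op (G i) (k i)) {..<v} (f i)"
    by metis
  have iso': "magma_isomorphic {..<v} (f i) (carrier (G i)) (Aff_op (G i) (k i))" if "i \<in> I" for i
    using magma_isomorphic_sym[OF iso[OF that]] mendelsohn_endo_affine(3)[OF G[OF that] k[OF that]]
    by (simp add: mendelsohn_quasigroup_def quasigroup.closed)
  show ?thesis unfolding num_affine_mendelsohn_def
  proof (rule card_quotient_eqI[OF equiv_isomorphism_relation])
    show "({..<v}, f i) \<in> ?A" if "i \<in> I" for i using f that by blast
    fix i j assume ij: "i \<in> I" "j \<in> I" "(({..<v}, f i), ({..<v}, f j)) \<in> isomorphism_relation ?A"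
    then have "magma_isomorphic {..<v} (f i) {..<v} (f j)" by (simp add: isomorphism_relation_def)
    then have "magma_isomorphic (carrier (G i)) (Aff_op (G i) (k i)) (carrier (G j)) (Aff_op (G j) (k j))"
      using magma_isomorphic_trans iso iso' ij by metis
    then show "i = j"
      using magma_isomorphic_Aff_iff[OF G[OF ij(1)] k[OF ij(1)] G[OF ij(2)] k[OF ij(2)]] dist[of i j] ij
      by blast
  next
    fix a assume a: "a \<in> ?A"
    obtain V h where Vh: "a = (V, h)" by fastforce
    then have fin: "finite V" and card: "card V = v" and Q: "mendelsohn_quasigroup V h"
      and aff: "affine_quasigroup V h"
      using a by (auto simp: affine_mendelsohn_quasigroups_def)
    obtain H :: "nat monoid" and l where H: "comm_group H" and l: "l \<in> iso H H"
      and VH: "magma_isomorphic V h (carrier H) (Aff_op H l)"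
      using aff unfolding affine_quasigroup_def by blast
    interpret H: comm_group H by (rule H)
    have lc: "l x \<in> carrier H" if "x \<in> carrier H" for x
      using l that by (auto simp: iso_def hom_def)
    have "mendelsohn_quasigroup (carrier H) (Aff_op H l)"
      by (rule mendelsohn_quasigroup_transport[OF VH Q]) (simp add: Aff_op_def one_minus_def lc)
    then have endo: "mendelsohn_endo H l" using l by (auto intro!: mendelsohn_endoI H simp: iso_def)
    have "order H = v"
      using VH card unfolding magma_isomorphic_def order_def by (metis bij_betw_same_card)
    then obtain i where i: "i \<in> I" and "\<exists>\<phi>\<in>iso H (G i). \<forall>x\<in>carrier H. \<phi> (l x) = k i (\<phi> x)"
      using compl[OF H _ endo] by blast
    then have "magma_isomorphic (carrier H) (Aff_op H l) (carrier (G i)) (Aff_op (G i) (k i))"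
      using magma_isomorphic_Aff_iff[OF H endo G[OF i] k[OF i]] by blast
    then have "magma_isomorphic V h {..<v} (f i)"
      using magma_isomorphic_trans VH iso[OF i] by metis
    then show "\<exists>i\<in>I. (a, ({..<v}, f i)) \<in> isomorphism_relation ?A"
      using a f i Vh by (auto simp: isomorphism_relation_def)
  qed
qed

section \<open>Roots of \<open>t\<^sup>2 - t + 1\<close> modulo \<open>n\<close>\<close>

text \<open>The polynomial is the sixth cyclotomic polynomial. Its roots modulo \<open>n\<close> are
  recorded by their least nonnegative residues, so that distinct roots are distinct
  integers.\<close>

definition sixth_roots :: "nat \<Rightarrow> int set" where
  "sixth_roots n = {c. 0 \<le> c \<and> c < int n \<and> int n dvd c\<^sup>2 - c + 1}"

lemma mod_mem_sixth_roots:
  assumes "n > 0" and "int n dvd c\<^sup>2 - c + 1"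
  shows "c mod int n \<in> sixth_roots n"
proof -
  have "[(c mod int n)\<^sup>2 - c mod int n + 1 = c\<^sup>2 - c + 1] (mod int n)"
    by (intro cong_add cong_diff cong_pow cong_refl) (simp_all add: cong_def)
  then show ?thesis using assms by (simp add: sixth_roots_def cong_dvd_iff)
qed

text \<open>The polynomial has discriminant -3: four times its value at \<open>c\<close> exceeds
  \<open>(2 * c - 1)^2\<close> by 3. A double root modulo \<open>p\<close> would force
  \<open>p\<close> to divide 3.\<close>

lemma prime_dvd_sixth_root_discriminant:
  fixes c :: int and p :: nat
  assumes p: "prime p" "p \<noteq> 3" and c: "int p dvd c\<^sup>2 - c + 1"
  shows "\<not> int p dvd 2 * c - 1"
proof
  assume "int p dvd 2 * c - 1"
  then have "int p dvd 4 * (c\<^sup>2 - c + 1) - (2 * c - 1) * (2 * c - 1)"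
    by (rule dvd_diff[OF dvd_mult[OF c] dvd_mult])
  also have "4 * (c\<^sup>2 - c + 1) - (2 * c - 1) * (2 * c - 1) = 3"
    by (simp add: algebra_simps power2_eq_square)
  finally have "p dvd 3" using int_dvd_int_iff[of p 3] by simp
  then show False using p primes_dvd_imp_eq[of p 3] by simp
qed

text \<open>The two roots of the polynomial sum to 1, so the second one is \<open>1 - c\<close>. For
  a further root \<open>x\<close>, the modulus divides \<open>(x - c) * (x - (1 - c))\<close>. These
  factors differ by \<open>2 * c - 1\<close>, which is prime to \<open>p\<close>, so one of them is
  a unit and the other absorbs all of \<open>p ^ e\<close>.\<close>

lemma card_sixth_roots_prime_power:
  fixes c :: int
  assumes p: "prime p" "p \<noteq> 3" and e: "e > 0" and c: "int (p ^ e) dvd c\<^sup>2 - c + 1"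
  shows "card (sixth_roots (p ^ e)) = 2"
proof -
  let ?n = "int (p ^ e)"
  have pn: "int p dvd ?n" using e by simp
  have pos: "?n > 0" using p prime_gt_0_nat by simp
  have prime: "prime (int p)" using p by simp
  have disc: "\<not> int p dvd 2 * c - 1"
    using prime_dvd_sixth_root_discriminant[OF p] dvd_trans[OF pn c] by blast
  have "sixth_roots (p ^ e) = {c mod ?n, (1 - c) mod ?n}"
  proof
    show "sixth_roots (p ^ e) \<subseteq> {c mod ?n, (1 - c) mod ?n}"
    proof
      fix x assume "x \<in> sixth_roots (p ^ e)"
      then have x: "0 \<le> x" "x < ?n" "?n dvd x\<^sup>2 - x + 1" by (auto simp: sixth_roots_def)
      have "?n dvd (x\<^sup>2 - x + 1) - (c\<^sup>2 - c + 1)" using x c by (intro dvd_diff)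
      also have "(x\<^sup>2 - x + 1) - (c\<^sup>2 - c + 1) = (x - c) * (x - (1 - c))"
        by (simp add: algebra_simps power2_eq_square)
      finally have dvd: "?n dvd (x - c) * (x - (1 - c))" .
      have "\<not> (int p dvd x - c \<and> int p dvd x - (1 - c))"
        using disc dvd_diff[of "int p" "x - (1 - c)" "x - c"] by auto
      then have "coprime ?n (x - c) \<or> coprime ?n (x - (1 - c))"
        using prime by (auto simp: prime_imp_coprime)
      then have "?n dvd x - c \<or> ?n dvd x - (1 - c)"
        using dvd by (metis coprime_dvd_mult_left_iff coprime_dvd_mult_right_iff)
      then have "x mod ?n = c mod ?n \<or> x mod ?n = (1 - c) mod ?n"
        by (simp add: mod_eq_dvd_iff)
      then show "x \<in> {c mod ?n, (1 - c) mod ?n}" using x by simp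
    qed
    have "(1 - c)\<^sup>2 - (1 - c) + 1 = c\<^sup>2 - c + 1" by (simp add: algebra_simps power2_eq_square)
    then have "?n dvd (1 - c)\<^sup>2 - (1 - c) + 1" using c by (simp only:)
    then show "{c mod ?n, (1 - c) mod ?n} \<subseteq> sixth_roots (p ^ e)"
      using mod_mem_sixth_roots[OF _ c] mod_mem_sixth_roots[of "p ^ e" "1 - c"] pos by auto
  qed
  moreover have "c mod ?n \<noteq> (1 - c) mod ?n"
    using disc pn by (auto simp: mod_eq_dvd_iff algebra_simps dest: dvd_trans)
  ultimately show ?thesis by simp
qed

text \<open>A suitable power of a primitive root is an element \<open>b\<close> of order 3. It is a
  root of \<open>t^2 + t + 1\<close>, and so its negative is a root of
  \<open>t^2 - t + 1\<close>.\<close>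

lemma sixth_root_mod_prime_exists:
  assumes p: "prime p" and mod: "[p = 1] (mod 3)"
  obtains c :: int where "int p dvd c\<^sup>2 - c + 1"
proof -
  have "p > 1" using p prime_gt_1_nat by blast
  have "3 dvd p - 1" using mod \<open>p > 1\<close> by (metis cong_altdef_nat less_imp_le)
  then obtain q where q: "p - 1 = 3 * q" by blast
  have "q > 0" using q \<open>p > 1\<close> by simp
  obtain g where g: "residue_primroot p g"
    using prime_primitive_root_exists[of p] p \<open>p > 1\<close> by auto
  then have ord: "ord p g = 3 * q" using totient_prime[OF p] q by (simp add: residue_primroot_def)
  define a where "a = g ^ q"
  have "[a ^ 3 = 1] (mod p)"
    using ord by (simp add: a_def ord_divides' mult.commute flip: power_mult)
  have "\<not> [a = 1] (mod p)"
    using ord \<open>q > 0\<close> by (auto simp: a_def ord_divides' dest: dvd_imp_le)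
  define b where "b = int a"
  have "int p dvd b ^ 3 - 1"
    using \<open>[a ^ 3 = 1] (mod p)\<close> unfolding b_def
    by (metis cong_iff_dvd_diff cong_int_iff of_nat_1 of_nat_power)
  moreover have "b ^ 3 - 1 = (b - 1) * ((-b)\<^sup>2 - (-b) + 1)"
    by (simp add: algebra_simps power2_eq_square power3_eq_cube)
  moreover have "\<not> int p dvd b - 1"
    using \<open>\<not> [a = 1] (mod p)\<close> unfolding b_def
    by (metis cong_iff_dvd_diff cong_int_iff of_nat_1)
  moreover have "prime (int p)" using p by simp
  ultimately have "int p dvd (-b)\<^sup>2 - (-b) + 1"
    by (simp only: prime_dvd_mult_iff) blast
  then show thesis using that by blast
qed

text \<open>Hensel lifting: the derivative \<open>2 c - 1\<close> is invertible because \<open>p\<close> differs from 3.\<close>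

lemma sixth_root_lift:
  fixes c :: int
  assumes p: "prime p" "p \<noteq> 3" and c: "int p dvd c\<^sup>2 - c + 1"
  obtains b :: int where "int (p\<^sup>2) dvd b\<^sup>2 - b + 1"
proof -
  obtain m where m: "c\<^sup>2 - c + 1 = int p * m" using c by blast
  have "coprime (int p) (2 * c - 1)"
    using prime_dvd_sixth_root_discriminant[OF p c] p by (simp add: prime_imp_coprime)
  then obtain s where "[(2 * c - 1) * s = 1] (mod int p)"
    using cong_solve_coprime_int coprime_commute by metis
  then have "[(2 * c - 1) * s * m = 1 * m] (mod int p)" by (rule cong_scalar_right)
  then obtain t where t: "(2 * c - 1) * s * m - m = int p * t"
    by (auto simp: cong_iff_dvd_diff)
  \<comment> \<open>This is one Newton step: \<open>int p * m\<close> is the value at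
    \<open>c\<close>, and \<open>s\<close> inverts the derivative modulo \<open>p\<close>.\<close>
  define b where "b = c - int p * (s * m)"
  have "b\<^sup>2 - b + 1 = (c\<^sup>2 - c + 1) - int p * ((2 * c - 1) * s * m) + int p * int p * (s * m)\<^sup>2"
    by (simp add: b_def algebra_simps power2_eq_square)
  also have "\<dots> = int p * int p * ((s * m)\<^sup>2 - t)"
    using m t by (simp add: algebra_simps)
  finally have "b\<^sup>2 - b + 1 = int p * int p * ((s * m)\<^sup>2 - t)" .
  then show thesis by (intro that[of b]) (simp add: power2_eq_square)
qed

lemma fermat_int:
  fixes c :: int
  assumes p: "prime p" and c: "\<not> int p dvd c"
  shows "[c ^ (p - 1) = 1] (mod int p)"
proof -
  define a where "a = nat (c mod int p)"
  have a: "[int a = c] (mod int p)"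
    using p prime_gt_0_nat by (simp add: a_def cong_def)
  have "\<not> p dvd a"
  proof
    assume "p dvd a"
    then have "c mod int p = 0" using cong_sym[OF a] by (auto simp: cong_def)
    then show False using c by (simp add: dvd_eq_mod_eq_0)
  qed
  then have "[int (a ^ (p - 1)) = int 1] (mod int p)"
    using fermat_theorem[OF p] by (simp only: cong_int_iff)
  then have "[int a ^ (p - 1) = 1] (mod int p)" by simp
  then show ?thesis by (rule cong_trans[OF cong_sym[OF cong_pow[OF a]]])
qed

text \<open>A root satisfies \<open>c^3 = -1\<close>, and here \<open>p - 1 = 3 * q + 1\<close>.
  Fermat's theorem then gives \<open>c * (-1)^q = 1\<close>, so \<open>c\<close> is 1 or -1 modulo
  \<open>p\<close>. At these places the polynomial takes the values 1 and 3, neither of which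
  \<open>p\<close> divides.\<close>

lemma sixth_roots_prime_mod_3_eq_2:
  assumes p: "prime p" and mod: "[p = 2] (mod 3)"
  shows "\<not> int p dvd c\<^sup>2 - c + 1"
proof
  assume c: "int p dvd c\<^sup>2 - c + 1"
  have gt1: "p > 1" using p prime_gt_1_nat by blast
  have ge: "p \<ge> 2" using gt1 by simp
  then have "3 dvd p - 2" using mod by (simp add: cong_altdef_nat)
  then obtain q where "p - 2 = 3 * q" by blast
  then have q: "p - 1 = Suc (3 * q)" using ge by simp
  have prime: "prime (int p)" using p by simp
  have "\<not> int p dvd c"
  proof
    assume "int p dvd c"
    then have "int p dvd (c\<^sup>2 - c + 1) - c * (c - 1)" using c by (intro dvd_diff) auto
    then have "int p dvd 1" by (simp add: algebra_simps power2_eq_square)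
    then show False using prime by auto
  qed
  then have "[c ^ (p - 1) = 1] (mod int p)"
    using fermat_int[OF p] by blast
  moreover have "[c ^ 3 = - 1] (mod int p)"
  proof -
    have "c ^ 3 - (- 1) = (c + 1) * (c\<^sup>2 - c + 1)"
      by (simp add: algebra_simps power2_eq_square power3_eq_cube)
    then show ?thesis using c by (simp add: cong_iff_dvd_diff)
  qed
  then have "[c * (c ^ 3) ^ q = c * (- 1) ^ q] (mod int p)"
    by (intro cong_mult cong_pow cong_refl)
  ultimately have "[c * (- 1) ^ q = 1] (mod int p)"
    unfolding q power_Suc power_mult by (metis cong_sym cong_trans)
  then have "int p dvd c * (- 1) ^ q - 1" by (simp add: cong_iff_dvd_diff)
  then consider "int p dvd c - 1" | "int p dvd c + 1"
    by (cases "even q") (auto simp: dvd_minus_iff[of _ "c + 1", symmetric])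
  then show False
  proof cases
    case 1
    then have "int p dvd (c\<^sup>2 - c + 1) - c * (c - 1)" using c by (intro dvd_diff) auto
    then have "int p dvd 1" by (simp add: algebra_simps power2_eq_square)
    then show False using prime by auto
  next
    case 2
    then have "int p dvd (c\<^sup>2 - c + 1) - (c - 2) * (c + 1)" using c by (intro dvd_diff) auto
    then have "int p dvd 3" by (simp add: algebra_simps power2_eq_square)
    then have "p dvd 3" using int_dvd_int_iff[of p 3] by simp
    then have "p = 3" using p primes_dvd_imp_eq[of p 3] by simp
    then show False using mod by (simp add: cong_def)
  qed
qed

lemma card_sixth_roots_mod_3_eq_1:
  assumes p: "prime p" and mod: "[p = 1] (mod 3)"
  shows "card (sixth_roots p) = 2" and "card (sixth_roots (p\<^sup>2)) = 2"
proof -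
  have p3: "p \<noteq> 3" using mod by (auto simp: cong_def)
  obtain c where c: "int p dvd c\<^sup>2 - c + 1" using sixth_root_mod_prime_exists[OF p mod] by blast
  then show "card (sixth_roots p) = 2"
    using card_sixth_roots_prime_power[OF p p3, of 1 c] by simp
  obtain b where "int (p\<^sup>2) dvd b\<^sup>2 - b + 1" using sixth_root_lift[OF p p3 c] by blast
  then show "card (sixth_roots (p\<^sup>2)) = 2"
    using card_sixth_roots_prime_power[OF p p3, of 2 b] by simp
qed

lemma sixth_roots_mod_3_eq_2:
  assumes p: "prime p" and mod: "[p = 2] (mod 3)"
  shows "sixth_roots p = {}" and "sixth_roots (p\<^sup>2) = {}"
proof -
  have "int p dvd int (p\<^sup>2)" by simp
  then have "\<not> int (p\<^sup>2) dvd c\<^sup>2 - c + 1" for c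
    using sixth_roots_prime_mod_3_eq_2[OF p mod, of c] dvd_trans[of "int p" "int (p\<^sup>2)"] by blast
  then show "sixth_roots p = {}" "sixth_roots (p\<^sup>2) = {}"
    using sixth_roots_prime_mod_3_eq_2[OF p mod] unfolding sixth_roots_def by blast+
qed

lemma sixth_roots_3: "sixth_roots 3 = {2}"
proof -
  have "c \<in> sixth_roots 3 \<longleftrightarrow> c = 2" for c
  proof -
    consider "c < 0" | "c = 0" | "c = 1" | "c = 2" | "c \<ge> 3" by linarith
    then show ?thesis by cases (auto simp: sixth_roots_def)
  qed
  then show ?thesis by blast
qed

text \<open>The root 2 modulo 3 is a double root, and none of its lifts 2, 5 and 8 is a root modulo
  9. The proof simply runs through all residues.\<close>

lemma sixth_roots_9: "sixth_roots 9 = {}"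
proof -
  have "c \<notin> sixth_roots 9" for c
  proof -
    consider "c < 0" | "c = 0" | "c = 1" | "c = 2" | "c = 3" | "c = 4" | "c = 5" | "c = 6"
      | "c = 7" | "c = 8" | "c \<ge> 9" by linarith
    then show ?thesis by cases (auto simp: sixth_roots_def)
  qed
  then show ?thesis by blast
qed

section \<open>Modules on cyclic and elementary Abelian groups\<close>

text \<open>One family covers both shapes over a single type, as the counting lemma requires:
  \<open>int_mod_pair n 1\<close> is cyclic and \<open>int_mod_pair p p\<close> is elementary
  Abelian.\<close>

abbreviation int_mod_pair :: "nat \<Rightarrow> nat \<Rightarrow> (int \<times> int) monoid" where
  "int_mod_pair m n \<equiv> integer_mod_group m \<times>\<times> integer_mod_group n"

lemma comm_group_int_mod_pair: "comm_group (int_mod_pair m n)"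
proof -
  interpret group "int_mod_pair m n" by (rule DirProd_group) simp_all
  show ?thesis by (rule group_comm_groupI) (auto simp: add.commute)
qed

lemma order_int_mod_pair:
  assumes "m > 0" "n > 0"
  shows "order (int_mod_pair m n) = m * n"
  using assms by (simp add: order_def carrier_integer_mod_group card_cartesian_product)

lemma int_pow_int_mod_pair:
  assumes "x \<in> carrier (int_mod_pair m n)"
  shows "x [^]\<^bsub>int_mod_pair m n\<^esub> (c::int) = ((c * fst x) mod int m, (c * snd x) mod int n)"
proof -
  have "group (int_mod_pair m n)" using comm_group_int_mod_pair comm_group_def by blast
  moreover have "fst \<in> hom (int_mod_pair m n) (integer_mod_group m)"
    "snd \<in> hom (int_mod_pair m n) (integer_mod_group n)"
    by (auto simp: hom_def)
  ultimately show ?thesis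
    using assms by (intro prod_eqI) (simp_all add: hom_int_pow int_pow_integer_mod_group)
qed

section \<open>Exponents, bases and independence in Abelian groups\<close>

context comm_group
begin

lemma int_pow_mod:
  fixes i :: int
  assumes x: "x \<in> carrier G" and 1: "x [^] int n = \<one>"
  shows "x [^] (i mod int n) = x [^] i"
proof -
  have "x [^] i = x [^] (int n * (i div int n) + i mod int n)" by simp
  also have "\<dots> = (x [^] int n) [^] (i div int n) \<otimes> x [^] (i mod int n)"
    by (simp only: int_pow_mult[OF x] int_pow_pow[OF x])
  finally show ?thesis using x 1 by simp
qed

lemma ord_eq_prime:
  assumes "prime p" and "x \<in> carrier G" "x \<noteq> \<one>" and "x [^] int p = \<one>"
  shows "ord x = p"
proof -
  have "ord x dvd p" using assms by (simp add: int_pow_eq_id)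
  then show ?thesis using assms ord_eq_1 by (auto simp: prime_nat_iff)
qed

lemma mendelsohn_endo_int_pow:
  fixes c :: int
  assumes "\<And>x. x \<in> carrier G \<Longrightarrow> x [^] (c\<^sup>2 - c + 1) = \<one>"
  shows "mendelsohn_endo G (\<lambda>x. x [^] c)"
  unfolding mendelsohn_endo_def
proof (intro conjI ballI)
  show "(\<lambda>x. x [^] c) \<in> hom G G" by (auto simp: hom_def int_pow_distrib)
  fix x assume x: "x \<in> carrier G"
  have "x [^] (c * c + 1 - c) = \<one>"
    using assms[OF x] by (simp add: power2_eq_square algebra_simps)
  then show "(x [^] c) [^] c \<otimes> x = x [^] c"
    using x by (simp add: int_pow_pow int_pow_diff int_pow_mult inv_solve_right')
qed

lemma mendelsohn_endo_int_pow_sixth_root: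
  fixes c :: int
  assumes c: "c \<in> sixth_roots n" and exp: "\<And>x. x \<in> carrier G \<Longrightarrow> x [^] int n = \<one>"
  shows "mendelsohn_endo G (\<lambda>x. x [^] c)"
proof (rule mendelsohn_endo_int_pow)
  fix x assume x: "x \<in> carrier G"
  obtain t where "c\<^sup>2 - c + 1 = int n * t" using c by (auto simp: sixth_roots_def)
  then show "x [^] (c\<^sup>2 - c + 1) = \<one>"
    using exp[OF x] x by (simp flip: int_pow_pow)
qed

text \<open>The relation evaluated at an element of order \<open>n\<close> forces \<open>n\<close>
  to divide \<open>a^2 - a + 1\<close>. Reducing \<open>a\<close> modulo \<open>n\<close> changes no
  power, because \<open>n\<close> annihilates the group.\<close>

lemma sixth_root_of_mendelsohn_endo:
  fixes a :: int
  assumes k: "mendelsohn_endo G k" and a: "\<And>x. x \<in> carrier G \<Longrightarrow> k x = x [^] a"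
    and exp: "\<And>x. x \<in> carrier G \<Longrightarrow> x [^] int n = \<one>" and g: "g \<in> carrier G" "ord g = n" and n: "n > 0"
  shows "\<exists>c\<in>sixth_roots n. \<forall>x\<in>carrier G. k x = x [^] c"
proof
  have "g [^] (a * a) \<otimes> g = g [^] a"
    using k g by (auto simp: mendelsohn_endo_def a int_pow_pow dest!: bspec[where x = g])
  then have "g [^] (a * a + 1 - a) = \<one>"
    using g by (simp add: int_pow_diff int_pow_mult inv_solve_right')
  then have "int n dvd a\<^sup>2 - a + 1"
    using g by (simp add: int_pow_eq_id power2_eq_square algebra_simps)
  then show "a mod int n \<in> sixth_roots n" by (rule mod_mem_sixth_roots[OF n])
  show "\<forall>x\<in>carrier G. k x = x [^] (a mod int n)"
    using a exp by (simp add: int_pow_mod)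
qed

text \<open>Independence makes the map injective, and comparing orders makes it surjective.\<close>

lemma iso_int_mod_pair:
  assumes u: "u \<in> carrier G" "u [^] int m = \<one>" and w: "w \<in> carrier G" "w [^] int n = \<one>"
    and mn: "m > 0" "n > 0" "order G = m * n"
    and indep: "\<And>i j :: int. u [^] i \<otimes> w [^] j = \<one> \<Longrightarrow> int m dvd i \<and> int n dvd j"
  shows "(\<lambda>(i, j). u [^] i \<otimes> w [^] j) \<in> iso (int_mod_pair m n) G"
proof -
  let ?h = "\<lambda>(i, j). u [^] (i::int) \<otimes> w [^] (j::int)"
  interpret Z: comm_group "int_mod_pair m n" by (rule comm_group_int_mod_pair)
  have hom: "?h \<in> hom (int_mod_pair m n) G"
    using u w by (auto simp: hom_def int_pow_mod int_pow_mult m_ac)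
  interpret h: group_hom "int_mod_pair m n" G ?h using hom by unfold_locales
  have fin: "finite (carrier G)" using mn by (metis order_gt_0_iff_finite mult_pos_pos)
  have inj: "inj_on ?h (carrier (int_mod_pair m n))"
    unfolding h.inj_on_one_iff
  proof (intro allI impI)
    fix x assume x: "x \<in> carrier (int_mod_pair m n)" "?h x = \<one>"
    obtain i j where "x = (i, j)" by fastforce
    then show "x = \<one>\<^bsub>int_mod_pair m n\<^esub>"
      using x mn indep[of i j] by (auto simp: carrier_integer_mod_group dest: zdvd_imp_le)
  qed
  then have "card (?h ` carrier (int_mod_pair m n)) = card (carrier G)"
    using mn order_int_mod_pair[of m n] by (simp add: card_image order_def)
  then have "?h ` carrier (int_mod_pair m n) = carrier G"
    using fin u w by (intro card_subset_eq) auto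
  then show ?thesis using hom inj by (simp add: iso_def bij_betw_def)
qed

lemma iso_int_mod_pair_cyclic:
  assumes g: "g \<in> carrier G" "ord g = order G" and n: "order G > 0"
  shows "(\<lambda>(i, j). g [^] i) \<in> iso (int_mod_pair (order G) 1) G"
proof -
  have "(\<lambda>(i, j). g [^] i \<otimes> \<one> [^] j) \<in> iso (int_mod_pair (order G) 1) G"
    using g n by (intro iso_int_mod_pair) (auto simp: int_pow_eq_id)
  also have "(\<lambda>(i, j). g [^] i \<otimes> \<one> [^] j) = (\<lambda>(i :: int, j :: int). g [^] i)"
    using g by (auto simp: fun_eq_iff)
  finally show ?thesis .
qed

lemma hom_cyclic_eq_int_pow:
  assumes g: "g \<in> carrier G" "carrier G \<subseteq> range (\<lambda>i::int. g [^] i)" and k: "k \<in> hom G G"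
  shows "\<exists>a::int. \<forall>x\<in>carrier G. k x = x [^] a"
proof -
  interpret k: group_hom G G k using k by unfold_locales
  obtain a :: int where a: "k g = g [^] a" using subsetD[OF g(2) k.hom_closed[OF g(1)]] by auto
  have "k x = x [^] a" if x: "x \<in> carrier G" for x
  proof -
    obtain i :: int where "x = g [^] i" using subsetD[OF g(2) x] by auto
    then show ?thesis using g a by (simp add: k.hom_int_pow int_pow_pow mult.commute)
  qed
  then show ?thesis by blast
qed

text \<open>If \<open>p\<close> did not divide \<open>j\<close>, then \<open>j\<close> would be
  invertible modulo \<open>p\<close> and \<open>w\<close> would be a power of \<open>u\<close>.
  Hence the factor in \<open>w\<close> is trivial, and \<open>i\<close> is a multiple of the order
  \<open>p\<close> of \<open>u\<close>.\<close>

lemma independent_of_prime_exponent: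
  fixes i j :: int
  assumes p: "prime p" and exp: "\<And>x. x \<in> carrier G \<Longrightarrow> x [^] int p = \<one>"
    and u: "u \<in> carrier G" "u \<noteq> \<one>" and w: "w \<in> carrier G" "w \<notin> range (\<lambda>i::int. u [^] i)"
    and eq: "u [^] i \<otimes> w [^] j = \<one>"
  shows "int p dvd i \<and> int p dvd j"
proof -
  have j: "int p dvd j"
  proof (rule ccontr)
    assume "\<not> int p dvd j"
    then have "coprime j (int p)" using p prime_imp_coprime[of "int p" j] by (simp add: coprime_commute)
    then obtain s where "[j * s = 1] (mod int p)" using cong_solve_coprime_int by blast
    then obtain t where t: "j * s - 1 = int p * t" by (auto simp: cong_iff_dvd_diff)
    have "w [^] j \<otimes> u [^] i = \<one>" using eq u w by (simp add: m_comm)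
    then have wj: "w [^] j = u [^] (- i)"
      using u w inv_equality[of "w [^] j" "u [^] i"] by (simp add: int_pow_neg)
    have "j * s - int p * t = 1" using t by simp
    then have "w = w [^] (j * s - int p * t)" using w by simp
    also have "\<dots> = (w [^] j) [^] s \<otimes> inv ((w [^] int p) [^] t)"
      using w by (simp add: int_pow_diff int_pow_pow)
    also have "\<dots> = u [^] (- i * s)"
      using exp[OF w(1)] u by (simp only: wj int_pow_pow) simp
    finally show False using w by blast
  qed
  then obtain t where "j = int p * t" by blast
  then have "w [^] j = \<one>" using exp[OF w(1)] w by (simp flip: int_pow_pow)
  then have "u [^] i = \<one>" using eq u by simp
  moreover have "ord u = p" using ord_eq_prime[OF p u] exp u by blast
  ultimately have "int p dvd i" using u by (simp add: int_pow_eq_id)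
  then show ?thesis using j by blast
qed

text \<open>If \<open>u\<close> and \<open>x\<close> are independent, the eigenvalue of \<open>u \<otimes> x\<close> agrees with those of \<open>u\<close> and \<open>x\<close>.\<close>

lemma locally_scalar_imp_scalar:
  assumes p: "prime p" and exp: "\<And>x. x \<in> carrier G \<Longrightarrow> x [^] int p = \<one>"
    and k: "k \<in> hom G G" and loc: "\<And>x. x \<in> carrier G \<Longrightarrow> k x \<in> range (\<lambda>i::int. x [^] i)"
  shows "\<exists>a::int. \<forall>x\<in>carrier G. k x = x [^] a"
proof (cases "carrier G = {\<one>}")
  case True
  then show ?thesis using loc[of \<one>] by auto
next
  case False
  interpret k: group_hom G G k using k by unfold_locales
  obtain u where u: "u \<in> carrier G" "u \<noteq> \<one>" using False by blast
  obtain a :: int where a: "k u = u [^] a" using loc[OF u(1)] by blast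
  have "k x = x [^] a" if x: "x \<in> carrier G" for x
  proof (cases "x \<in> range (\<lambda>i::int. u [^] i)")
    case True
    then obtain i :: int where "x = u [^] i" by blast
    then show ?thesis using u a by (simp add: k.hom_int_pow int_pow_pow mult.commute)
  next
    case False
    obtain b :: int where b: "k x = x [^] b" using loc[OF x] by blast
    obtain d :: int where d: "k (u \<otimes> x) = (u \<otimes> x) [^] d" using loc[of "u \<otimes> x"] u x by auto
    have "u [^] a \<otimes> x [^] b = u [^] d \<otimes> x [^] d"
      using d u x by (simp add: a b int_pow_distrib)
    moreover have "u [^] (a - d) \<otimes> x [^] (b - d) = (u [^] a \<otimes> x [^] b) \<otimes> inv (u [^] d \<otimes> x [^] d)"
      using u x by (simp add: int_pow_diff inv_mult m_ac)
    ultimately have "u [^] (a - d) \<otimes> x [^] (b - d) = \<one>" using u x by simp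
    then have "int p dvd a - d \<and> int p dvd b - d"
      using independent_of_prime_exponent[OF p exp u x False] by blast
    then have "int p dvd (a - d) - (b - d)" by (meson dvd_diff)
    then have "int p dvd a - b" by simp
    then obtain t where t: "a - b = int p * t" by blast
    have "x [^] (a - b) = \<one>" unfolding t using exp[OF x] x by (simp flip: int_pow_pow)
    then show ?thesis using x b by (simp add: int_pow_diff inv_solve_right')
  qed
  then show ?thesis by blast
qed

end

section \<open>Normal forms for the endomorphism\<close>

lemma equivariant_iso_sym:
  assumes G: "group G" and \<phi>: "\<phi> \<in> iso G H" and k: "\<And>x. x \<in> carrier G \<Longrightarrow> k x \<in> carrier G"
    and eq: "\<And>x. x \<in> carrier G \<Longrightarrow> \<phi> (k x) = l (\<phi> x)"
  shows "\<exists>\<psi>\<in>iso H G. \<forall>y\<in>carrier H. \<psi> (l y) = k (\<psi> y)"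
proof
  let ?\<psi> = "inv_into (carrier G) \<phi>"
  show "?\<psi> \<in> iso H G" using G \<phi> by (rule group.iso_set_sym)
  have bij: "bij_betw \<phi> (carrier G) (carrier H)" using \<phi> by (simp add: iso_def)
  show "\<forall>y\<in>carrier H. ?\<psi> (l y) = k (?\<psi> y)"
  proof
    fix y assume "y \<in> carrier H"
    then obtain x where "x \<in> carrier G" "y = \<phi> x" using bij by (auto simp: bij_betw_def)
    then show "?\<psi> (l y) = k (?\<psi> y)"
      using k eq bij_betw_inv_into_left[OF bij] by (simp flip: eq)
  qed
qed

text \<open>The companion matrix of \<open>t\<^sup>2 - t + 1\<close>.\<close>

definition companion :: "nat \<Rightarrow> int \<times> int \<Rightarrow> int \<times> int" where
  "companion n x = ((- snd x) mod int n, (fst x + snd x) mod int n)"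

lemma companion_closed:
  assumes "n > 0"
  shows "companion n x \<in> carrier (int_mod_pair n n)"
  using assms by (simp add: companion_def carrier_integer_mod_group)

text \<open>A companion matrix annihilates its own polynomial, over any modulus.\<close>

lemma mendelsohn_endo_companion:
  assumes "n > 0"
  shows "mendelsohn_endo (int_mod_pair n n) (companion n)"
  unfolding mendelsohn_endo_def
proof (intro conjI ballI)
  show "companion n \<in> hom (int_mod_pair n n) (int_mod_pair n n)"
  proof (rule homI)
    fix x y assume "x \<in> carrier (int_mod_pair n n)" "y \<in> carrier (int_mod_pair n n)"
    show "companion n (x \<otimes>\<^bsub>int_mod_pair n n\<^esub> y) = companion n x \<otimes>\<^bsub>int_mod_pair n n\<^esub> companion n y"
      by (simp add: companion_def mult_DirProd' mod_simps)
        (simp add: algebra_simps minus_diff_commute[of "snd x" "snd y"])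
  qed (rule companion_closed[OF assms])
  fix x assume "x \<in> carrier (int_mod_pair n n)"
  show "companion n (companion n x) \<otimes>\<^bsub>int_mod_pair n n\<^esub> x = companion n x"
    by (simp add: companion_def mult_DirProd' mod_simps)
qed

text \<open>On a cyclic group \<open>k\<close> is a power map. Homomorphisms commute with power
  maps, so every group isomorphism to the standard group is automatically equivariant.\<close>

lemma (in comm_group) mendelsohn_endo_cyclic:
  assumes k: "mendelsohn_endo G k" and g: "g \<in> carrier G" "ord g = order G" and n: "order G > 0"
  shows "\<exists>c\<in>sixth_roots (order G). \<exists>\<phi>\<in>iso G (int_mod_pair (order G) 1).
    \<forall>x\<in>carrier G. \<phi> (k x) = \<phi> x [^]\<^bsub>int_mod_pair (order G) 1\<^esub> c"
proof -
  let ?Z = "int_mod_pair (order G) 1"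
  interpret Z: comm_group ?Z by (rule comm_group_int_mod_pair)
  have iso: "(\<lambda>(i, j). g [^] i) \<in> iso ?Z G" by (rule iso_int_mod_pair_cyclic[OF g n])
  then have "carrier G = (\<lambda>(i, j). g [^] i) ` carrier ?Z" by (auto simp: iso_def bij_betw_def)
  then have "carrier G \<subseteq> range (\<lambda>i::int. g [^] i)" by auto
  then obtain a :: int where "\<And>x. x \<in> carrier G \<Longrightarrow> k x = x [^] a"
    using hom_cyclic_eq_int_pow[OF g(1)] k unfolding mendelsohn_endo_def by blast
  then obtain c where c: "c \<in> sixth_roots (order G)" "\<And>x. x \<in> carrier G \<Longrightarrow> k x = x [^] c"
    using sixth_root_of_mendelsohn_endo[OF k _ _ g n, of a] pow_order_eq_1 by (auto simp: int_pow_int)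
  obtain \<phi> where \<phi>: "\<phi> \<in> iso G ?Z" using Z.iso_set_sym[OF iso] by blast
  have "\<phi> (k x) = \<phi> x [^]\<^bsub>?Z\<^esub> c" if "x \<in> carrier G" for x
    using \<phi> hom_int_pow[of \<phi> G ?Z x c, OF _ that is_group Z.is_group] that
    by (simp add: c(2) iso_def)
  then show ?thesis using c(1) \<phi> by blast
qed

text \<open>Since \<open>k u\<close> is not a power of \<open>u\<close>, the two form a basis. The
  relation gives \<open>k (k u) = k u - u\<close> additively, which is the second column of the
  companion matrix.\<close>

lemma (in comm_group) mendelsohn_endo_companion_iso:
  assumes p: "prime p" and exp: "\<And>x. x \<in> carrier G \<Longrightarrow> x [^] int p = \<one>" and order: "order G = p\<^sup>2"
    and k: "mendelsohn_endo G k" and u: "u \<in> carrier G" "k u \<notin> range (\<lambda>i::int. u [^] i)"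
  shows "\<exists>\<phi>\<in>iso G (int_mod_pair p p). \<forall>x\<in>carrier G. \<phi> (k x) = companion p (\<phi> x)"
proof -
  let ?Z = "int_mod_pair p p" and ?h = "\<lambda>(i, j). u [^] (i::int) \<otimes> k u [^] (j::int)"
  interpret k: group_hom G G k using k by unfold_locales (simp add: mendelsohn_endo_def)
  have pos: "p > 0" using p prime_gt_0_nat by blast
  have "u \<noteq> \<one>" using u(2) k.hom_one by (metis int_pow_0 rangeI)
  have iso: "?h \<in> iso ?Z G"
  proof (rule iso_int_mod_pair)
    show "int p dvd i \<and> int p dvd j" if "u [^] i \<otimes> k u [^] j = \<one>" for i j :: int
      using independent_of_prime_exponent[OF p exp u(1) \<open>u \<noteq> \<one>\<close> _ u(2) that] u(1) by simp
  qed (use u exp pos order in \<open>simp_all add: power2_eq_square\<close>)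
  have "k (k u) \<otimes> u = k u" using k u by (simp add: mendelsohn_endo_def)
  then have kk: "k (k u) = k u \<otimes> inv u" using u by (metis inv_solve_right k.hom_closed)
  have "?h (companion p x) = k (?h x)" for x
  proof -
    obtain i j where x: "x = (i, j)" by fastforce
    show ?thesis using u exp
      by (simp add: x companion_def int_pow_mod k.hom_int_pow kk int_pow_distrib int_pow_neg
          int_pow_mult int_pow_inv m_ac)
  qed
  then show ?thesis
    using equivariant_iso_sym[OF _ iso, of "companion p" k] companion_closed[OF pos]
      comm_group_int_mod_pair by (auto simp: comm_group_def)
qed

lemma (in comm_group) iso_int_mod_pair_elementary:
  assumes p: "prime p" and exp: "\<And>x. x \<in> carrier G \<Longrightarrow> x [^] int p = \<one>" and order: "order G = p\<^sup>2"
  shows "\<exists>\<phi>. \<phi> \<in> iso (int_mod_pair p p) G"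
proof -
  have p1: "p > 1" using p prime_gt_1_nat by blast
  have "p < p\<^sup>2" using p1 by (simp add: power2_eq_square)
  have "order G \<noteq> 1" using order p1 by simp
  then have "carrier G \<noteq> {\<one>}" by (auto simp: order_def)
  then obtain u where u: "u \<in> carrier G" "u \<noteq> \<one>" by blast
  have "\<not> carrier G \<subseteq> range (\<lambda>i::int. u [^] i)"
  proof
    assume sub: "carrier G \<subseteq> range (\<lambda>i::int. u [^] i)"
    \<comment> \<open>The powers of \<open>u\<close> number at most \<open>p\<close>, too few to
      fill a group of order \<open>p\<^sup>2\<close>; a second basis vector \<open>w\<close>
      therefore exists.\<close>
    have "carrier G \<subseteq> (\<lambda>i::int. u [^] i) ` {0..<int p}"
    proof
      fix x assume "x \<in> carrier G"
      then obtain i :: int where "x = u [^] i" using sub by auto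
      then have "x = u [^] (i mod int p)" using int_pow_mod u exp by simp
      then show "x \<in> (\<lambda>i::int. u [^] i) ` {0..<int p}" using p1 by auto
    qed
    then have "card (carrier G) \<le> card {0..<int p}" by (intro surj_card_le) auto
    then show False using order \<open>p < p\<^sup>2\<close> by (simp add: order_def)
  qed
  then obtain w where w: "w \<in> carrier G" "w \<notin> range (\<lambda>i::int. u [^] i)" by blast
  have "(\<lambda>(i, j). u [^] i \<otimes> w [^] j) \<in> iso (int_mod_pair p p) G"
  proof (rule iso_int_mod_pair)
    show "int p dvd i \<and> int p dvd j" if "u [^] i \<otimes> w [^] j = \<one>" for i j :: int
      using independent_of_prime_exponent[OF p exp u w that] by blast
  qed (use u w exp p1 order in \<open>simp_all add: power2_eq_square\<close>)
  then show ?thesis by blast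
qed

lemma (in comm_group) mendelsohn_endo_elementary:
  assumes p: "prime p" and exp: "\<And>x. x \<in> carrier G \<Longrightarrow> x [^] int p = \<one>" and order: "order G = p\<^sup>2"
    and k: "mendelsohn_endo G k"
  shows "(\<exists>c\<in>sixth_roots p. \<exists>\<phi>\<in>iso G (int_mod_pair p p).
      \<forall>x\<in>carrier G. \<phi> (k x) = \<phi> x [^]\<^bsub>int_mod_pair p p\<^esub> c) \<or>
    (\<exists>\<phi>\<in>iso G (int_mod_pair p p). \<forall>x\<in>carrier G. \<phi> (k x) = companion p (\<phi> x))"
proof (cases "\<forall>x\<in>carrier G. k x \<in> range (\<lambda>i::int. x [^] i)")
  case True
  let ?Z = "int_mod_pair p p"
  interpret Z: comm_group ?Z by (rule comm_group_int_mod_pair)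
  have p1: "p > 1" using p prime_gt_1_nat by blast
  obtain a :: int where a: "\<And>x. x \<in> carrier G \<Longrightarrow> k x = x [^] a"
    using locally_scalar_imp_scalar[OF p exp _ bspec[OF True]] k by (auto simp: mendelsohn_endo_def)
  have "order G \<noteq> 1" using order p1 by simp
  then have "carrier G \<noteq> {\<one>}" by (auto simp: order_def)
  then obtain u where u: "u \<in> carrier G" "u \<noteq> \<one>" by blast
  obtain c where c: "c \<in> sixth_roots p" "\<And>x. x \<in> carrier G \<Longrightarrow> k x = x [^] c"
    using sixth_root_of_mendelsohn_endo[OF k a exp u(1) ord_eq_prime[OF p u exp[OF u(1)]]] p1 by auto
  obtain \<phi> where \<phi>: "\<phi> \<in> iso G ?Z"
    using iso_int_mod_pair_elementary[OF p exp order] Z.iso_set_sym by blast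
  have "\<phi> (k x) = \<phi> x [^]\<^bsub>?Z\<^esub> c" if "x \<in> carrier G" for x
    using \<phi> hom_int_pow[of \<phi> G ?Z x c, OF _ that is_group Z.is_group] that
    by (simp add: c(2) iso_def)
  then show ?thesis using c(1) \<phi> by blast
next
  case False
  then show ?thesis using mendelsohn_endo_companion_iso[OF p exp order k] by blast
qed

section \<open>Distinguishing the normal forms\<close>

lemma int_mod_pair_int_pow_eq_one:
  assumes "m dvd N" "n dvd N" "x \<in> carrier (int_mod_pair m n)"
  shows "x [^]\<^bsub>int_mod_pair m n\<^esub> int N = \<one>\<^bsub>int_mod_pair m n\<^esub>"
  using assms by (simp only: int_pow_int_mod_pair) simp

lemma iso_int_pow_eq:
  fixes c d :: int
  assumes "group G" "group H" and \<phi>: "\<phi> \<in> iso G H"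
    and eq: "\<phi> (x [^]\<^bsub>G\<^esub> c) = \<phi> x [^]\<^bsub>H\<^esub> d" and x: "x \<in> carrier G"
  shows "x [^]\<^bsub>G\<^esub> c = x [^]\<^bsub>G\<^esub> d"
proof -
  interpret G: group G by fact
  have "\<phi> (x [^]\<^bsub>G\<^esub> c) = \<phi> (x [^]\<^bsub>G\<^esub> d)"
    using eq \<phi> hom_int_pow[of \<phi> G H x d, OF _ x assms(1,2)] by (simp add: iso_def)
  then show ?thesis using \<phi> x by (auto simp: iso_def bij_betw_def inj_on_eq_iff)
qed

text \<open>Power maps commute with \<open>\<phi>\<close>, so both exponents act alike on the
  source. The element \<open>(1, 0)\<close> has order \<open>m\<close> and detects them modulo
  \<open>m\<close>.\<close>

lemma sixth_roots_scalar_iso_eq: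
  assumes m: "m > 1" and c: "c \<in> sixth_roots m" and d: "d \<in> sixth_roots m"
    and \<phi>: "\<phi> \<in> iso (int_mod_pair m n) (int_mod_pair m n)"
    and eq: "\<And>x. x \<in> carrier (int_mod_pair m n) \<Longrightarrow>
      \<phi> (x [^]\<^bsub>int_mod_pair m n\<^esub> c) = \<phi> x [^]\<^bsub>int_mod_pair m n\<^esub> d"
  shows "c = d"
proof -
  interpret comm_group "int_mod_pair m n" by (rule comm_group_int_mod_pair)
  have x: "(1, 0) \<in> carrier (int_mod_pair m n)" using m by simp
  have "(1, 0) [^]\<^bsub>int_mod_pair m n\<^esub> c = (1, 0) [^]\<^bsub>int_mod_pair m n\<^esub> d"
    by (rule iso_int_pow_eq[OF is_group is_group \<phi> eq[OF x] x])
  then have "c mod int m = d mod int m" by (simp only: int_pow_int_mod_pair[OF x]) simp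
  then show ?thesis using c d by (simp add: sixth_roots_def)
qed

text \<open>The companion matrix sends \<open>(1, 0)\<close> to \<open>(0, 1)\<close>, while every
  power of \<open>(1, 0)\<close> has second coordinate 0.\<close>

lemma companion_neq_int_pow:
  assumes n: "n > 1"
  shows "companion n (1, 0) \<noteq> (1, 0) [^]\<^bsub>int_mod_pair n n\<^esub> (c::int)"
proof -
  have "(1, 0) \<in> carrier (int_mod_pair n n)" using n by simp
  then show ?thesis using n by (simp only: int_pow_int_mod_pair companion_def) simp
qed

text \<open>The exponent \<open>p\<close> annihilates the elementary group but not the element
  \<open>(1, 0)\<close> of the cyclic one.\<close>

lemma not_iso_int_mod_pair_cyclic_elementary:
  assumes p: "p > 1"
  shows "\<phi> \<notin> iso (int_mod_pair (p\<^sup>2) 1) (int_mod_pair p p)"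
proof
  assume \<phi>: "\<phi> \<in> iso (int_mod_pair (p\<^sup>2) 1) (int_mod_pair p p)"
  interpret G: comm_group "int_mod_pair (p\<^sup>2) 1" by (rule comm_group_int_mod_pair)
  interpret H: comm_group "int_mod_pair p p" by (rule comm_group_int_mod_pair)
  have p2: "p < p\<^sup>2" using p by (simp add: power2_eq_square)
  have x: "(1, 0) \<in> carrier (int_mod_pair (p\<^sup>2) 1)" using p p2 by simp
  have hom: "\<phi> \<in> hom (int_mod_pair (p\<^sup>2) 1) (int_mod_pair p p)" using \<phi> by (simp add: iso_def)
  have \<phi>x: "\<phi> (1, 0) \<in> carrier (int_mod_pair p p)" using hom_in_carrier[OF hom x] .
  \<comment> \<open>The neutral element is written as a power with exponent 0 so that
    \<open>iso_int_pow_eq\<close> can cancel \<open>\<phi>\<close>.\<close>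
  have "\<phi> ((1, 0) [^]\<^bsub>int_mod_pair (p\<^sup>2) 1\<^esub> int p) = \<phi> (1, 0) [^]\<^bsub>int_mod_pair p p\<^esub> (0::int)"
    using hom_int_pow[OF hom x G.is_group H.is_group, of "int p"]
      int_mod_pair_int_pow_eq_one[OF dvd_refl dvd_refl \<phi>x] by simp
  then have "(1, 0) [^]\<^bsub>int_mod_pair (p\<^sup>2) 1\<^esub> int p = (1, 0) [^]\<^bsub>int_mod_pair (p\<^sup>2) 1\<^esub> (0::int)"
    by (rule iso_int_pow_eq[OF G.is_group H.is_group \<phi> _ x])
  then have "int p mod int (p\<^sup>2) = 0" by (simp only: int_pow_int_mod_pair[OF x]) simp
  then show False using p p2 by (simp flip: of_nat_mod)
qed

section \<open>The count\<close>

text \<open>A group of prime order is generated by any nontrivial element, so only the scalars on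
  the cyclic group occur.\<close>

lemma num_affine_mendelsohn_prime:
  assumes p: "prime p"
  shows "num_affine_mendelsohn p = card (sixth_roots p)"
proof (rule num_affine_mendelsohn_eqI)
  let ?Z = "int_mod_pair p 1"
  have p1: "p > 1" using p prime_gt_1_nat by blast
  then show "p > 0" by simp
  interpret Z: comm_group ?Z by (rule comm_group_int_mod_pair)
  show "comm_group ?Z" by (rule comm_group_int_mod_pair)
  show "order ?Z = p" using p1 order_int_mod_pair[of p 1] by simp
  show "mendelsohn_endo ?Z (\<lambda>x. x [^]\<^bsub>?Z\<^esub> c)" if "c \<in> sixth_roots p" for c
    by (rule Z.mendelsohn_endo_int_pow_sixth_root[OF that int_mod_pair_int_pow_eq_one]) simp_all
  show "c = d" if "c \<in> sixth_roots p" "d \<in> sixth_roots p" "\<phi> \<in> iso ?Z ?Z"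
    "\<And>x. x \<in> carrier ?Z \<Longrightarrow> \<phi> (x [^]\<^bsub>?Z\<^esub> c) = \<phi> x [^]\<^bsub>?Z\<^esub> d" for c d \<phi>
    using sixth_roots_scalar_iso_eq[OF p1 that] .
  fix H :: "nat monoid" and l
  assume H: "comm_group H" "order H = p" and l: "mendelsohn_endo H l"
  interpret H: comm_group H by (rule H(1))
  have "carrier H \<noteq> {\<one>\<^bsub>H\<^esub>}" using H(2) p1 by (auto simp: order_def)
  then obtain g where g: "g \<in> carrier H" "g \<noteq> \<one>\<^bsub>H\<^esub>" by blast
  have "g [^]\<^bsub>H\<^esub> int p = \<one>\<^bsub>H\<^esub>" using H.pow_order_eq_1[OF g(1)] H(2) by (simp add: int_pow_int)
  then have "H.ord g = order H" using H.ord_eq_prime[OF p g] H(2) by simp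
  then show "\<exists>c\<in>sixth_roots p. \<exists>\<phi>\<in>iso H ?Z. \<forall>x\<in>carrier H. \<phi> (l x) = \<phi> x [^]\<^bsub>?Z\<^esub> c"
    using H.mendelsohn_endo_cyclic[OF l g(1)] H(2) p1 by simp
qed

lemma num_affine_mendelsohn_prime_square:
  assumes p: "prime p"
  shows "num_affine_mendelsohn (p\<^sup>2) = card (sixth_roots (p\<^sup>2)) + card (sixth_roots p) + 1"
proof -
  let ?C = "int_mod_pair (p\<^sup>2) 1" and ?E = "int_mod_pair p p"
  \<comment> \<open>The three summands index the scalars on the cyclic group, the scalars on the
    elementary group, and the companion matrix.\<close>
  let ?I = "sixth_roots (p\<^sup>2) <+> (sixth_roots p <+> {()})"
  define G where "G = case_sum (\<lambda>_::int. ?C) (\<lambda>_::int + unit. ?E)"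
  define k where "k = case_sum (\<lambda>(c::int) x. x [^]\<^bsub>?C\<^esub> c)
    (case_sum (\<lambda>(c::int) x. x [^]\<^bsub>?E\<^esub> c) (\<lambda>_::unit. companion p))"
  have p1: "p > 1" using p prime_gt_1_nat by blast
  then have p2: "p\<^sup>2 > 1" by (rule one_less_power) simp
  interpret C: comm_group ?C by (rule comm_group_int_mod_pair)
  interpret E: comm_group ?E by (rule comm_group_int_mod_pair)
  have basis: "(1, 0) \<in> carrier ?E" using p1 by simp
  have sym: "inv_into (carrier ?E) \<phi> \<in> iso ?C ?E" if "\<phi> \<in> iso ?E ?C" for \<phi>
    using that by (rule E.iso_set_sym)
  have not_iso: "\<phi> \<notin> iso ?C ?E" "\<phi> \<notin> iso ?E ?C" for \<phi>
    using not_iso_int_mod_pair_cyclic_elementary[OF p1] sym by blast+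
  have "num_affine_mendelsohn (p\<^sup>2) = card ?I"
  proof (rule num_affine_mendelsohn_eqI[where G = G and k = k])
    show "p\<^sup>2 > 0" using p1 by simp
    show "comm_group (G i)" for i
      by (cases i) (simp_all add: G_def comm_group_int_mod_pair)
    show "order (G i) = p\<^sup>2" for i
      using p1 by (cases i) (simp_all add: G_def order_int_mod_pair power2_eq_square)
    show "mendelsohn_endo (G i) (k i)" if "i \<in> ?I" for i
      using that
    proof (elim PlusE)
      fix c assume "c \<in> sixth_roots (p\<^sup>2)" "i = Inl c"
      moreover have "mendelsohn_endo ?C (\<lambda>x. x [^]\<^bsub>?C\<^esub> c)"
        by (rule C.mendelsohn_endo_int_pow_sixth_root[OF \<open>c \<in> sixth_roots (p\<^sup>2)\<close>
              int_mod_pair_int_pow_eq_one]) simp_all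
      ultimately show ?thesis by (simp add: G_def k_def)
    next
      fix j c assume "c \<in> sixth_roots p" "j = Inl c" "i = Inr j"
      moreover have "mendelsohn_endo ?E (\<lambda>x. x [^]\<^bsub>?E\<^esub> c)"
        by (rule E.mendelsohn_endo_int_pow_sixth_root[OF \<open>c \<in> sixth_roots p\<close>
              int_mod_pair_int_pow_eq_one]) simp_all
      ultimately show ?thesis by (simp add: G_def k_def)
    qed (use p1 mendelsohn_endo_companion in \<open>simp_all add: G_def k_def\<close>)
    fix i j \<phi> assume ij: "i \<in> ?I" "j \<in> ?I" and iso: "\<phi> \<in> iso (G i) (G j)"
      and eq: "\<And>x. x \<in> carrier (G i) \<Longrightarrow> \<phi> (k i x) = k j (\<phi> x)"
    show "i = j"
    proof (cases i)
      case (Inl c)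
      then obtain d where d: "j = Inl d" using iso not_iso by (cases j) (simp_all add: G_def)
      then show ?thesis
        using Inl ij iso eq sixth_roots_scalar_iso_eq[OF p2, of c d \<phi> 1]
        by (simp add: G_def k_def Plus_def image_iff)
    next
      case (Inr i')
      then obtain j' where j: "j = Inr j'" using iso not_iso by (cases j) (simp_all add: G_def)
      have iso': "\<phi> \<in> iso ?E ?E" using iso Inr j by (simp add: G_def)
      have eq': "\<phi> (k (Inr i') x) = k (Inr j') (\<phi> x)" if "x \<in> carrier ?E" for x
        using eq[of x] that unfolding Inr j by (simp add: G_def)
      consider c d where "i' = Inl c" "j' = Inl d" | c where "i' = Inl c" "j' = Inr ()"
        | d where "i' = Inr ()" "j' = Inl d" | "i' = Inr ()" "j' = Inr ()"
        by (cases i'; cases j') auto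
      then show ?thesis
      proof cases
        case 1
        then show ?thesis
          using Inr j ij eq' iso' sixth_roots_scalar_iso_eq[OF p1, of c d \<phi> p] by (auto simp: k_def)
      next
        case 2
        \<comment> \<open>The scalar is on the source side here, so the test vector
          \<open>(1, 0)\<close> is pulled back along \<open>\<phi>\<close>; the companion matrix
          would then act on it as a scalar.\<close>
        have "\<phi> ` carrier ?E = carrier ?E" using iso' unfolding iso_def bij_betw_def by simp
        then have "(1, 0) \<in> \<phi> ` carrier ?E" using basis by (simp only:)
        then obtain x where x: "\<phi> x = (1, 0)" "x \<in> carrier ?E" by (metis imageE)
        have "\<phi> (x [^]\<^bsub>?E\<^esub> c) = (1, 0) [^]\<^bsub>?E\<^esub> c"
          using hom_int_pow[of \<phi> ?E ?E x c] iso' x E.is_group by (simp add: iso_def)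
        then have "companion p (1, 0) = (1, 0) [^]\<^bsub>?E\<^esub> c"
          using eq'[OF x(2)] 2 x by (simp add: k_def)
        then show ?thesis using companion_neq_int_pow[OF p1] by blast
      next
        case 3
        have "\<phi> ((1, 0) [^]\<^bsub>?E\<^esub> d) = \<phi> (1, 0) [^]\<^bsub>?E\<^esub> d"
          using hom_int_pow[of \<phi> ?E ?E "(1, 0)" d] iso' basis E.is_group by (simp add: iso_def)
        then have "\<phi> (companion p (1, 0)) = \<phi> ((1, 0) [^]\<^bsub>?E\<^esub> d)"
          using eq'[OF basis] 3 by (simp add: k_def)
        moreover have "companion p (1, 0) \<in> carrier ?E" "(1, 0) [^]\<^bsub>?E\<^esub> d \<in> carrier ?E"
          using companion_closed[of p] p1 E.int_pow_closed[OF basis] by blast+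
        moreover have "inj_on \<phi> (carrier ?E)"
          using iso' unfolding iso_def bij_betw_def by simp
        ultimately have "companion p (1, 0) = (1, 0) [^]\<^bsub>?E\<^esub> d"
          by (metis inj_onD)
        then show ?thesis using companion_neq_int_pow[OF p1] by blast
      qed (use Inr j in simp)
    qed
  next
    fix H :: "nat monoid" and l
    assume H: "comm_group H" "order H = p\<^sup>2" and l: "mendelsohn_endo H l"
    interpret H: comm_group H by (rule H(1))
    show "\<exists>i\<in>?I. \<exists>\<phi>\<in>iso H (G i). \<forall>x\<in>carrier H. \<phi> (l x) = k i (\<phi> x)"
    \<comment> \<open>Element orders divide \<open>p\<^sup>2\<close>. Either one of them attains it
      and the group is cyclic, or all of them divide \<open>p\<close>.\<close>
    proof (cases "\<exists>g\<in>carrier H. H.ord g = p\<^sup>2")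
      case True
      then obtain g where g: "g \<in> carrier H" "H.ord g = order H" using H(2) by auto
      have "0 < p\<^sup>2" using p1 by simp
      then obtain c \<phi> where "c \<in> sixth_roots (p\<^sup>2)" "\<phi> \<in> iso H ?C"
        "\<forall>x\<in>carrier H. \<phi> (l x) = \<phi> x [^]\<^bsub>?C\<^esub> c"
        using H.mendelsohn_endo_cyclic[OF l g, unfolded H(2)] by blast
      then show ?thesis by (intro bexI[of _ "Inl c"] bexI[of _ \<phi>]) (simp_all add: G_def k_def InlI)
    next
      case False
      have exp: "x [^]\<^bsub>H\<^esub> int p = \<one>\<^bsub>H\<^esub>" if x: "x \<in> carrier H" for x
      proof -
        have "H.ord x dvd p\<^sup>2" using H.ord_dvd_group_order[OF x] H(2) by simp
        then obtain e where e: "e \<le> 2" "H.ord x = p ^ e" using divides_primepow_nat[OF p] by blast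
        then have "e \<noteq> 2" using False x by blast
        then have "H.ord x dvd p" using e le_imp_power_dvd[of e 1 p] by simp
        then show ?thesis using x by (simp add: H.int_pow_eq_id)
      qed
      consider c \<phi> where "c \<in> sixth_roots p" "\<phi> \<in> iso H ?E"
          "\<forall>x\<in>carrier H. \<phi> (l x) = \<phi> x [^]\<^bsub>?E\<^esub> c"
        | \<phi> where "\<phi> \<in> iso H ?E" "\<forall>x\<in>carrier H. \<phi> (l x) = companion p (\<phi> x)"
        using H.mendelsohn_endo_elementary[OF p exp H(2) l] by blast
      then show ?thesis
      proof cases
        case (1 c \<phi>)
        then show ?thesis
          by (intro bexI[of _ "Inr (Inl c)"] bexI[of _ \<phi>]) (simp_all add: G_def k_def InlI InrI)
      next
        case (2 \<phi>)
        then show ?thesis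
          by (intro bexI[of _ "Inr (Inr ())"] bexI[of _ \<phi>]) (simp_all add: G_def k_def InrI)
      qed
    qed
  qed
  moreover have "finite (sixth_roots n)" for n
    by (rule finite_subset[of _ "{0..<int n}"]) (auto simp: sixth_roots_def)
  ultimately show ?thesis by (simp add: card_Plus)
qed

theorem theorem2p12:
  fixes p :: nat
  assumes "prime p"
  shows "([p = 1] (mod 3) \<longrightarrow> num_affine_mendelsohn p = 2 \<and> num_affine_mendelsohn (p^2) = 5)
       \<and> ([p = 2] (mod 3) \<longrightarrow> num_affine_mendelsohn p = 0 \<and> num_affine_mendelsohn (p^2) = 1)
       \<and> (num_affine_mendelsohn 3 = 1 \<and> num_affine_mendelsohn 9 = 2)"
proof (intro conjI impI)
  note num = num_affine_mendelsohn_prime num_affine_mendelsohn_prime_square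
  show "num_affine_mendelsohn p = 2" "num_affine_mendelsohn (p\<^sup>2) = 5" if "[p = 1] (mod 3)"
    using num[OF assms] card_sixth_roots_mod_3_eq_1[OF assms that] by simp_all
  show "num_affine_mendelsohn p = 0" "num_affine_mendelsohn (p\<^sup>2) = 1" if "[p = 2] (mod 3)"
    using num[OF assms] sixth_roots_mod_3_eq_2[OF assms that] by simp_all
  have "prime (3 :: nat)" by simp
  then show "num_affine_mendelsohn 3 = 1" "num_affine_mendelsohn 9 = 2"
    \<comment> \<open>There is one root modulo 3 and none modulo 9, so order 9 contributes 0 + 1 +
      1.\<close>
    using num[of 3] sixth_roots_3 sixth_roots_9 by simp_all
qed

end
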